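(* Let $P:\Lambda_\infty^{\mathrm{op}}\to\mathbf{Set}$ be a paracyclic set and let $Q:\Phi_*\to\mathbf{Set}$ be a $\Gamma$-set. Suppose that $P$ and $Q$ have the same underlying simplicial set (i.e. $P\circ(\Delta^{\mathrm{op}}\to\Lambda_\infty^{\mathrm{op}})=Q\circ\mathsf{Cut}$ as functors $\Delta^{\mathrm{op}}\to\mathbf{Set}$), and that this simplicial set is $2$-Segal. Then $P$ is cyclic, i.e. it factors through $\Lambda_\infty^{\mathrm{op}}\to\Lambda^{\mathrm{op}}$, and there is a unique cosymmetric set $F:\Phi\to\mathbf{Set}$ such that the composite $\Lambda^{\mathrm{op}}\to\Phi\xrightarrow{F}\mathbf{Set}$ equals $P$ (regarded as a functor on $\Lambda^{\mathrm{op}}$) and the composite $\Phi_*\hookrightarrow\Phi\xrightarrow{F}\mathbf{Set}$ equals $Q$.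
   Context: All categories below have objects $[n]=\{0,1,\dots,n\}$, $n\ge 0$, and all functors below are the identity on objects. **Simplicial sets.** $\Delta$ is the simplex category (weakly order-preserving maps). A simplicial set is a functor $X_\bullet:\Delta^{\mathrm{op}}\to\mathbf{Set}$, with face maps $d_i^n:X_n\to X_{n-1}$ and degeneracy maps $s_i^n:X_n\to X_{n+1}$, $0\le i\le n$. It is *$2$-Segal* if for all $0<i<n$ the two commutative squares expressing $d_i d_0=d_0 d_{i+1}:X_{n+1}\to X_{n-1}$ and $d_i d_{n+1}=d_n d_i:X_{n+1}\to X_{n-1}$ are pullbacks; that is, $(d_{i+1},d_0):X_{n+1}\to X_n\times_{d_0,X_{n-1},d_i}X_n$ and $(d_i,d_{n+1}):X_{n+1}\to X_n\times_{d_n,X_{n-1},d_i}X_n$ are bijections. **Paracyclic and cyclic sets.** In the paracyclic category $\Lambda_\infty$, a morphism $[m]\to[n]$ is a weakly order-preserving map $f:\mathbb{Z}\to\mathbb{Z}$ with $f(x+m+1)=f(x)+n+1$ for all $x$. $\Delta$ embeds in $\Lambda_\infty$ by extending a map $\{0,\dots,m\}\to\{0,\dots,n\}$ uniquely to such an $f$. Let $T^n\in\mathrm{Aut}_{\Lambda_\infty}([n])$ be $T^n(i)=i+1$. The cyclic category $\Lambda$ is the quotient of $\Lambda_\infty$ by the relations $(T^n)^{n+1}=\mathrm{id}$ for all $n$. A paracyclic (cyclic) set is a functor $\Lambda_\infty^{\mathrm{op}}\to\mathbf{Set}$ ($\Lambda^{\mathrm{op}}\to\mathbf{Set}$). Equivalently,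 a paracyclic set is a simplicial set with invertible maps $\tau^n:X_n\to X_n$ (images of $T^n$) such that $d_i^n\tau^n=\tau^{n-1}d_{i+1}^n$ for $i<n$, $d_n^n\tau^n=d_0^n$, $s_i^n\tau^n=\tau^{n+1}s_{i+1}^n$ for $i<n$, $s_n^n\tau^n=(\tau^{n+1})^2s_0^n$; it is cyclic if moreover $(\tau^n)^{n+1}=\mathrm{id}$ for all $n$. **$\Gamma$-sets.** In $\Phi_*$, a morphism $[m]\to[n]$ is a map of sets $f:[m]\to[n]$ with $f(0)=0$. A $\Gamma$-set is a functor $\Phi_*\to\mathbf{Set}$. The functor $\mathsf{Cut}:\Delta^{\mathrm{op}}\to\Phi_*$ is given on generators by: for $0\le i<n$, $d_i^n:[n]\to[n-1]$ sends $k\mapsto k$ for $k\le i$ and $k\mapsto k-1$ for $k>i$; $d_n^n$ sends $k\mapsto k$ for $k<n$ and $n\mapsto 0$; $s_i^n:[n]\to[n+1]$ sends $k\mapsto k$ for $k\le i$ and $k\mapsto k+1$ for $k>i$. The underlying simplicial set of a $\Gamma$-set is obtained by composing with $\mathsf{Cut}$. **Cosymmetric sets.** $\Phi$ is the full subcategory of $\mathbf{Set}$ on the objects $[n]$, $n\ge 0$ (all maps of sets). $\Phi_*\hookrightarrow\Phi$ is the evident inclusion. A cosymmetric set is a functor $\Phi\to\mathbf{Set}$. The functor $\Lambda^{\mathrm{op}}\to\Phi$ restricts on $\Delta^{\mathrm{op}}$ to $\mathsf{Cut}$ followed by the inclusion $\Phi_*\hookrightarrow\Phi$, and sends $T^n$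 to the cyclic permutation $\tau^n:[n]\to[n]$, $\tau^n(0)=n$, $\tau^n(k)=k-1$ for $k\ge1$. *)

theory Defs
  imports Main "HOL-Library.FuncSet"
begin

section \<open>Categories with objects the natural numbers\<close>

text \<open>All categories have as objects the \<open>[n]\<close>, \<open>n \<ge> 0\<close>; the object \<open>[n]\<close> is represented by the
  number \<open>n\<close>. \<open>Comp C m n p g f\<close> is the composite of \<open>f : [m] \<rightarrow> [n]\<close> with \<open>g : [n] \<rightarrow> [p]\<close>.\<close>

record 'f nat_cat =
  Hom :: "nat \<Rightarrow> nat \<Rightarrow> 'f set"
  Ident :: "nat \<Rightarrow> 'f"
  Comp :: "nat \<Rightarrow> nat \<Rightarrow> nat \<Rightarrow> 'f \<Rightarrow> 'f \<Rightarrow> 'f"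

definition is_category :: "'f nat_cat \<Rightarrow> bool" where
  "is_category C \<longleftrightarrow>
     (\<forall>n. Ident C n \<in> Hom C n n) \<and>
     (\<forall>m n p f g. f \<in> Hom C m n \<longrightarrow> g \<in> Hom C n p \<longrightarrow> Comp C m n p g f \<in> Hom C m p) \<and>
     (\<forall>m n f. f \<in> Hom C m n \<longrightarrow> Comp C m m n f (Ident C m) = f \<and> Comp C m n n (Ident C n) f = f) \<and>
     (\<forall>m n p q f g h. f \<in> Hom C m n \<longrightarrow> g \<in> Hom C n p \<longrightarrow> h \<in> Hom C p q \<longrightarrow>
        Comp C m p q h (Comp C m n p g f) = Comp C m n q (Comp C n p q h g) f)"

definition op_cat :: "'f nat_cat \<Rightarrow> 'f nat_cat" where
  "op_cat C = \<lparr>Hom = (\<lambda>m n. Hom C n m), Ident = Ident C, Comp = (\<lambda>m n p g f. Comp C p n m f g)\<rparr>"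

text \<open>A functor that is the identity on objects is given by its action
  \<open>\<phi> m n : Hom C m n \<rightarrow> Hom D m n\<close> on arrows.\<close>

definition is_functor :: "'f nat_cat \<Rightarrow> 'g nat_cat \<Rightarrow> (nat \<Rightarrow> nat \<Rightarrow> 'f \<Rightarrow> 'g) \<Rightarrow> bool" where
  "is_functor C D \<phi> \<longleftrightarrow>
     (\<forall>m n f. f \<in> Hom C m n \<longrightarrow> \<phi> m n f \<in> Hom D m n) \<and>
     (\<forall>n. \<phi> n n (Ident C n) = Ident D n) \<and>
     (\<forall>m n p f g. f \<in> Hom C m n \<longrightarrow> g \<in> Hom C n p \<longrightarrow>
        \<phi> m p (Comp C m n p g f) = Comp D m n p (\<phi> n p g) (\<phi> m n f))"

definition op_functor :: "(nat \<Rightarrow> nat \<Rightarrow> 'f \<Rightarrow> 'g) \<Rightarrow> nat \<Rightarrow> nat \<Rightarrow> 'f \<Rightarrow> 'g" where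
  "op_functor \<phi> = (\<lambda>m n. \<phi> n m)"

section \<open>Set-valued functors\<close>

text \<open>Maps of sets are extensional functions, and the action is normalised to \<open>undefined\<close> on
  everything that is not an arrow. Hence two set-valued functors on \<open>C\<close> have the same values on all
  objects and arrows exactly if they are equal as records.\<close>

record ('f, 'a) set_functor =
  Ob :: "nat \<Rightarrow> 'a set"
  Ar :: "nat \<Rightarrow> nat \<Rightarrow> 'f \<Rightarrow> 'a \<Rightarrow> 'a"

definition is_set_functor :: "'f nat_cat \<Rightarrow> ('f, 'a) set_functor \<Rightarrow> bool" where
  "is_set_functor C X \<longleftrightarrow>
     (\<forall>m n f. f \<in> Hom C m n \<longrightarrow> Ar X m n f \<in> Ob X m \<rightarrow>\<^sub>E Ob X n) \<and>
     (\<forall>m n f. f \<notin> Hom C m n \<longrightarrow> Ar X m n f = undefined) \<and>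
     (\<forall>n. Ar X n n (Ident C n) = (\<lambda>x\<in>Ob X n. x)) \<and>
     (\<forall>m n p f g. f \<in> Hom C m n \<longrightarrow> g \<in> Hom C n p \<longrightarrow>
        Ar X m p (Comp C m n p g f) = compose (Ob X m) (Ar X n p g) (Ar X m n f))"

text \<open>The composite of \<open>\<phi> : C \<rightarrow> D\<close> and \<open>X : D \<rightarrow> Set\<close>.\<close>

definition precomp ::
  "'f nat_cat \<Rightarrow> (nat \<Rightarrow> nat \<Rightarrow> 'f \<Rightarrow> 'g) \<Rightarrow> ('g, 'a) set_functor \<Rightarrow> ('f, 'a) set_functor" where
  "precomp C \<phi> X =
     \<lparr>Ob = Ob X, Ar = (\<lambda>m n f. if f \<in> Hom C m n then Ar X m n (\<phi> m n f) else undefined)\<rparr>"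

section \<open>Simplicial sets\<close>

definition simplex_cat :: "(nat \<Rightarrow> nat) nat_cat" where
  "simplex_cat =
     \<lparr>Hom = (\<lambda>m n. {f \<in> {..m} \<rightarrow>\<^sub>E {..n}. mono_on {..m} f}),
      Ident = (\<lambda>n. \<lambda>k\<in>{..n}. k),
      Comp = (\<lambda>m n p g f. compose {..m} g f)\<rparr>"

abbreviation simplicial_set :: "(nat \<Rightarrow> nat, 'a) set_functor \<Rightarrow> bool" where
  "simplicial_set X \<equiv> is_set_functor (op_cat simplex_cat) X"

text \<open>The injection \<open>[n - 1] \<rightarrow> [n]\<close> omitting \<open>i\<close> (for \<open>n \<ge> 1\<close>) and the surjection
  \<open>[n + 1] \<rightarrow> [n]\<close> hitting \<open>i\<close> twice.\<close>

definition coface :: "nat \<Rightarrow> nat \<Rightarrow> nat \<Rightarrow> nat" where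
  "coface n i = (\<lambda>k\<in>{..n - 1}. if k < i then k else k + 1)"

definition codegeneracy :: "nat \<Rightarrow> nat \<Rightarrow> nat \<Rightarrow> nat" where
  "codegeneracy n i = (\<lambda>k\<in>{..n + 1}. if k \<le> i then k else k - 1)"

definition face :: "(nat \<Rightarrow> nat, 'a) set_functor \<Rightarrow> nat \<Rightarrow> nat \<Rightarrow> 'a \<Rightarrow> 'a" where
  "face X n i = Ar X n (n - 1) (coface n i)"

definition two_segal :: "(nat \<Rightarrow> nat, 'a) set_functor \<Rightarrow> bool" where
  "two_segal X \<longleftrightarrow> (\<forall>n i. 0 < i \<and> i < n \<longrightarrow>
     bij_betw (\<lambda>x. (face X (n + 1) (i + 1) x, face X (n + 1) 0 x))
       (Ob X (n + 1)) {(a, b) \<in> Ob X n \<times> Ob X n. face X n 0 a = face X n i b} \<and>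
     bij_betw (\<lambda>x. (face X (n + 1) i x, face X (n + 1) (n + 1) x))
       (Ob X (n + 1)) {(a, b) \<in> Ob X n \<times> Ob X n. face X n n a = face X n i b})"

section \<open>Paracyclic and cyclic sets\<close>

definition paracyclic_cat :: "(int \<Rightarrow> int) nat_cat" where
  "paracyclic_cat =
     \<lparr>Hom = (\<lambda>m n. {f. mono f \<and> (\<forall>x. f (x + int m + 1) = f x + int n + 1)}),
      Ident = (\<lambda>n. id),
      Comp = (\<lambda>m n p g f. g \<circ> f)\<rparr>"

abbreviation paracyclic_set :: "(int \<Rightarrow> int, 'a) set_functor \<Rightarrow> bool" where
  "paracyclic_set X \<equiv> is_set_functor (op_cat paracyclic_cat) X"

text \<open>The embedding of the simplex category into the paracyclic category.\<close>

definition simplex_extend :: "nat \<Rightarrow> nat \<Rightarrow> (nat \<Rightarrow> nat) \<Rightarrow> int \<Rightarrow> int" where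
  "simplex_extend m n f =
     (\<lambda>x. int (f (nat (x mod (int m + 1)))) + (int n + 1) * (x div (int m + 1)))"

definition rotation :: "int \<Rightarrow> int" where
  "rotation = (\<lambda>i. i + 1)"

text \<open>\<open>cyclic_cong m n\<close> is the congruence on the arrows \<open>[m] \<rightarrow> [n]\<close> of the paracyclic category
  generated by \<open>T\<^sup>n\<^sup>+\<^sup>1 = id\<close> on \<open>[n]\<close> for all \<open>n\<close>.\<close>

inductive cyclic_cong :: "nat \<Rightarrow> nat \<Rightarrow> (int \<Rightarrow> int) \<Rightarrow> (int \<Rightarrow> int) \<Rightarrow> bool" where
  gen: "cyclic_cong n n (rotation ^^ (n + 1)) id"
| refl: "f \<in> Hom paracyclic_cat m n \<Longrightarrow> cyclic_cong m n f f"
| sym: "cyclic_cong m n f g \<Longrightarrow> cyclic_cong m n g f"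
| trans: "cyclic_cong m n f g \<Longrightarrow> cyclic_cong m n g h \<Longrightarrow> cyclic_cong m n f h"
| comp: "cyclic_cong m n f f' \<Longrightarrow> cyclic_cong n p g g' \<Longrightarrow> cyclic_cong m p (g \<circ> f) (g' \<circ> f')"

definition cyclic_class :: "nat \<Rightarrow> nat \<Rightarrow> (int \<Rightarrow> int) \<Rightarrow> (int \<Rightarrow> int) set" where
  "cyclic_class m n f = {g. cyclic_cong m n f g}"

definition cyclic_cat :: "(int \<Rightarrow> int) set nat_cat" where
  "cyclic_cat =
     \<lparr>Hom = (\<lambda>m n. cyclic_class m n ` Hom paracyclic_cat m n),
      Ident = (\<lambda>n. cyclic_class n n id),
      Comp = (\<lambda>m n p G F. \<Union>g\<in>G. \<Union>f\<in>F. cyclic_class m p (g \<circ> f))\<rparr>"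

abbreviation cyclic_set :: "((int \<Rightarrow> int) set, 'a) set_functor \<Rightarrow> bool" where
  "cyclic_set X \<equiv> is_set_functor (op_cat cyclic_cat) X"

section \<open>\<open>\<Gamma>\<close>-sets and cosymmetric sets\<close>

definition Phi :: "(nat \<Rightarrow> nat) nat_cat" where
  "Phi =
     \<lparr>Hom = (\<lambda>m n. {..m} \<rightarrow>\<^sub>E {..n}),
      Ident = (\<lambda>n. \<lambda>k\<in>{..n}. k),
      Comp = (\<lambda>m n p g f. compose {..m} g f)\<rparr>"

definition Phi_pointed :: "(nat \<Rightarrow> nat) nat_cat" where
  "Phi_pointed = Phi\<lparr>Hom := (\<lambda>m n. {f \<in> {..m} \<rightarrow>\<^sub>E {..n}. f 0 = 0})\<rparr>"

abbreviation Gamma_set :: "(nat \<Rightarrow> nat, 'a) set_functor \<Rightarrow> bool" where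
  "Gamma_set X \<equiv> is_set_functor Phi_pointed X"

abbreviation cosymmetric_set :: "(nat \<Rightarrow> nat, 'a) set_functor \<Rightarrow> bool" where
  "cosymmetric_set X \<equiv> is_set_functor Phi X"

definition incl :: "nat \<Rightarrow> nat \<Rightarrow> (nat \<Rightarrow> nat) \<Rightarrow> nat \<Rightarrow> nat" where
  "incl m n f = f"

text \<open>The functor \<open>Cut\<close> from the opposite of the simplex category: \<open>f : [m] \<rightarrow> [n]\<close> gives a pointed
  map \<open>[n] \<rightarrow> [m]\<close>. An element \<open>k \<ge> 1\<close> of \<open>[n]\<close> stands for the gap between \<open>k - 1\<close> and \<open>k\<close>; it goes to
  the \<open>j\<close> with \<open>f (j - 1) < k \<le> f j\<close>, and to \<open>0\<close> if there is none.\<close>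

definition Cut :: "nat \<Rightarrow> nat \<Rightarrow> (nat \<Rightarrow> nat) \<Rightarrow> nat \<Rightarrow> nat" where
  "Cut n m f = (\<lambda>k\<in>{..n}. if \<exists>j\<le>m. k \<le> f j then LEAST j. j \<le> m \<and> k \<le> f j else 0)"

text \<open>The functor from the opposite of the cyclic category to \<open>Phi\<close>: the left adjoint
  \<open>k \<mapsto> min {j. k \<le> f j}\<close> of a representative \<open>f : [m] \<rightarrow> [n]\<close>, reduced modulo \<open>m + 1\<close>.\<close>

definition left_adjoint :: "(int \<Rightarrow> int) \<Rightarrow> int \<Rightarrow> int" where
  "left_adjoint f k = (LEAST j. k \<le> f j)"

definition cyclic_to_Phi :: "nat \<Rightarrow> nat \<Rightarrow> (int \<Rightarrow> int) set \<Rightarrow> nat \<Rightarrow> nat" where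
  "cyclic_to_Phi n m A =
     (\<lambda>k\<in>{..n}. nat (left_adjoint (SOME f. f \<in> A) (int k) mod (int m + 1)))"

section \<open>The definitions agree with their characterisations\<close>

text \<open>In particular: \<open>simplex_extend\<close> is the unique extension, \<open>Cut\<close> is a functor with the prescribed
  values on the generators, and \<open>cyclic_to_Phi\<close> is a functor that restricts to \<open>Cut\<close> and sends
  \<open>T\<^sup>n\<close> to the prescribed cyclic permutation.\<close>

lemma category_simplex: "is_category simplex_cat"
  unfolding is_category_def simplex_cat_def
  by (auto simp: compose_def PiE_iff mono_on_def extensional_def fun_eq_iff)

lemma category_Phi: "is_category Phi"
  unfolding is_category_def Phi_def
  by (auto simp: compose_def PiE_iff extensional_def fun_eq_iff)

lemma category_Phi_pointed: "is_category Phi_pointed"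
  unfolding is_category_def Phi_pointed_def Phi_def
  by (auto simp: compose_def PiE_iff extensional_def fun_eq_iff)

lemma category_paracyclic: "is_category paracyclic_cat"
  unfolding is_category_def paracyclic_cat_def
  by (auto simp: mono_def)

lemma functor_incl: "is_functor Phi_pointed Phi incl"
  by (auto simp: is_functor_def Phi_pointed_def Phi_def incl_def)

subsection \<open>The embedding of the simplex category\<close>

lemma paracyclic_shift:
  assumes "f \<in> Hom paracyclic_cat m n"
  shows "f (x + t * (int m + 1)) = f x + t * (int n + 1)"
proof -
  have step: "f (y + int m + 1) = f y + int n + 1" for y
    using assms by (simp add: paracyclic_cat_def)
  show ?thesis
  proof (induction t rule: int_induct[where k = 0])
    case (step1 i)
    then show ?case using step[of "x + i * (int m + 1)"] by (simp add: algebra_simps)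
  next
    case (step2 i)
    then show ?case using step[of "x + (i - 1) * (int m + 1)"] by (simp add: algebra_simps)
  qed simp
qed

lemma simplex_extend_small: "k \<le> m \<Longrightarrow> simplex_extend m n f (int k) = int (f k)"
  by (simp add: simplex_extend_def)

lemma simplex_extend_Hom:
  assumes "f \<in> Hom simplex_cat m n"
  shows "simplex_extend m n f \<in> Hom paracyclic_cat m n"
proof -
  have b: "f k \<le> n" if "k \<le> m" for k
    using assms that by (auto simp: simplex_cat_def)
  have mo: "f k \<le> f l" if "k \<le> l" "l \<le> m" for k l
    using assms that by (auto simp: simplex_cat_def mono_on_def)
  have r: "nat (x mod (int m + 1)) \<le> m" for x
    using pos_mod_bound[of "int m + 1" x] by linarith
  have "simplex_extend m n f x \<le> simplex_extend m n f y" if "x \<le> y" for x y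
  proof (cases "x div (int m + 1) = y div (int m + 1)")
    case True
    then have "x mod (int m + 1) \<le> y mod (int m + 1)"
      using that by (simp add: minus_div_mult_eq_mod [symmetric])
    then show ?thesis
      unfolding simplex_extend_def True using mo[OF nat_mono r] by simp
  next
    case False
    have "x div (int m + 1) \<le> y div (int m + 1)"
      using that by (simp add: zdiv_mono1)
    with False have "x div (int m + 1) + 1 \<le> y div (int m + 1)" by simp
    then have "(int n + 1) * (x div (int m + 1) + 1) \<le> (int n + 1) * (y div (int m + 1))"
      by (intro mult_left_mono) auto
    with b[OF r[of x]] show ?thesis
      unfolding simplex_extend_def by (simp add: algebra_simps)
  qed
  moreover have "simplex_extend m n f (x + int m + 1) = simplex_extend m n f x + int n + 1" for x
  proof -
    have "(x + (int m + 1)) div (int m + 1) = x div (int m + 1) + 1"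
      by (rule div_add_self2) simp
    moreover have "(x + (int m + 1)) mod (int m + 1) = x mod (int m + 1)" by simp
    ultimately show ?thesis
      unfolding simplex_extend_def by (simp add: algebra_simps)
  qed
  ultimately show ?thesis by (simp add: paracyclic_cat_def mono_def)
qed

lemma simplex_extend_unique:
  assumes "g \<in> Hom paracyclic_cat m n" and "\<forall>k\<le>m. g (int k) = int (f k)"
  shows "g = simplex_extend m n f"
proof
  fix x
  let ?r = "x mod (int m + 1)"
  have "0 \<le> ?r" "?r \<le> int m"
    using pos_mod_bound[of "int m + 1" x] by auto
  then have "g ?r = int (f (nat ?r))"
    using assms(2) by (metis nat_le_iff nat_0_le)
  then show "g x = simplex_extend m n f x"
    using paracyclic_shift[OF assms(1), of ?r "x div (int m + 1)"]
    by (simp only: simplex_extend_def mod_div_mult_eq) (simp add: mult.commute)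
qed

lemma functor_simplex_extend: "is_functor simplex_cat paracyclic_cat simplex_extend"
  unfolding is_functor_def
proof (intro conjI allI impI)
  show "simplex_extend m n f \<in> Hom paracyclic_cat m n" if "f \<in> Hom simplex_cat m n" for m n f
    using that by (rule simplex_extend_Hom)
  show "simplex_extend n n (Ident simplex_cat n) = Ident paracyclic_cat n" for n
    by (rule simplex_extend_unique[symmetric]) (auto simp: paracyclic_cat_def simplex_cat_def mono_def)
next
  fix m n p f g
  assume f: "f \<in> Hom simplex_cat m n" and g: "g \<in> Hom simplex_cat n p"
  have c: "simplex_extend n p g \<circ> simplex_extend m n f \<in> Hom paracyclic_cat m p"
    using simplex_extend_Hom[OF f] simplex_extend_Hom[OF g] by (auto simp: paracyclic_cat_def mono_def)
  have "\<forall>k\<le>m. (simplex_extend n p g \<circ> simplex_extend m n f) (int k) = int (compose {..m} g f k)"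
    using f by (auto simp: simplex_extend_small compose_def simplex_cat_def PiE_iff)
  from simplex_extend_unique[OF c this]
  show "simplex_extend m p (Comp simplex_cat m n p g f) =
      Comp paracyclic_cat m n p (simplex_extend n p g) (simplex_extend m n f)"
    by (simp add: simplex_cat_def paracyclic_cat_def del: comp_apply)
qed

subsection \<open>The cyclic category\<close>

lemma rotation_Hom: "rotation \<in> Hom paracyclic_cat n n"
  by (simp add: rotation_def paracyclic_cat_def mono_def)

lemma rotation_power: "rotation ^^ k = (\<lambda>x. x + int k)"
  by (induction k) (auto simp: rotation_def fun_eq_iff)

lemma cyclic_cong_shift:
  assumes "cyclic_cong m n f g"
  shows "f \<in> Hom paracyclic_cat m n \<and> g \<in> Hom paracyclic_cat m n \<and>
    (\<exists>t. \<forall>x. g x = f x + t * (int n + 1))"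
  using assms
proof (induction rule: cyclic_cong.induct)
  case (gen n)
  then show ?case
    by (auto simp: rotation_power paracyclic_cat_def mono_def intro!: exI[of _ "-1"])
next
  case (refl f m n)
  then show ?case by (auto intro!: exI[of _ 0])
next
  case (sym m n f g)
  then obtain t where "\<forall>x. g x = f x + t * (int n + 1)" by blast
  with sym show ?case by (auto intro!: exI[of _ "-t"])
next
  case (trans m n f g h)
  then obtain t s where "\<forall>x. g x = f x + t * (int n + 1)" "\<forall>x. h x = g x + s * (int n + 1)" by blast
  with trans show ?case by (auto intro!: exI[of _ "t + s"] simp: algebra_simps)
next
  case (comp m n f f' p g g')
  then obtain t s where t: "\<forall>x. f' x = f x + t * (int n + 1)"
    and s: "\<forall>x. g' x = g x + s * (int p + 1)" by blast
  have "g' (f' x) = g (f x) + (t + s) * (int p + 1)" for x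
    using s t paracyclic_shift[of g n p "f x" t] comp by (simp add: algebra_simps)
  moreover have "g \<circ> f \<in> Hom paracyclic_cat m p" "g' \<circ> f' \<in> Hom paracyclic_cat m p"
    using comp by (auto simp: paracyclic_cat_def mono_def)
  ultimately show ?case unfolding comp_apply by blast
qed

lemma cyclic_class_eq: "cyclic_cong m n f g \<Longrightarrow> cyclic_class m n f = cyclic_class m n g"
  unfolding cyclic_class_def using cyclic_cong.sym cyclic_cong.trans by blast

lemma cyclic_class_self: "f \<in> Hom paracyclic_cat m n \<Longrightarrow> f \<in> cyclic_class m n f"
  by (simp add: cyclic_class_def cyclic_cong.refl)

lemma cyclic_Comp:
  assumes "f \<in> Hom paracyclic_cat m n" "g \<in> Hom paracyclic_cat n p"
  shows "Comp cyclic_cat m n p (cyclic_class n p g) (cyclic_class m n f) = cyclic_class m p (g \<circ> f)"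
proof -
  have "cyclic_class m p (g' \<circ> f') = cyclic_class m p (g \<circ> f)"
    if "g' \<in> cyclic_class n p g" "f' \<in> cyclic_class m n f" for f' g'
    using that cyclic_class_eq[OF cyclic_cong.comp] unfolding cyclic_class_def
    by (metis mem_Collect_eq)
  then have "(\<Union>g'\<in>cyclic_class n p g. \<Union>f'\<in>cyclic_class m n f. cyclic_class m p (g' \<circ> f')) =
      cyclic_class m p (g \<circ> f)"
    using cyclic_class_self[OF assms(1)] cyclic_class_self[OF assms(2)] by blast
  then show ?thesis by (simp add: cyclic_cat_def)
qed

lemma functor_cyclic_class: "is_functor paracyclic_cat cyclic_cat cyclic_class"
  unfolding is_functor_def
proof (intro conjI allI impI)
  show "cyclic_class m n f \<in> Hom cyclic_cat m n" if "f \<in> Hom paracyclic_cat m n" for m n f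
    using that by (simp add: cyclic_cat_def)
  show "cyclic_class n n (Ident paracyclic_cat n) = Ident cyclic_cat n" for n
    by (simp add: cyclic_cat_def paracyclic_cat_def)
next
  fix m n p f g
  assume "f \<in> Hom paracyclic_cat m n" "g \<in> Hom paracyclic_cat n p"
  then show "cyclic_class m p (Comp paracyclic_cat m n p g f) =
      Comp cyclic_cat m n p (cyclic_class n p g) (cyclic_class m n f)"
    by (simp add: cyclic_Comp) (simp add: paracyclic_cat_def)
qed

lemma category_cyclic: "is_category cyclic_cat"
proof -
  have cl: "g \<circ> f \<in> Hom paracyclic_cat m p"
    if "f \<in> Hom paracyclic_cat m n" "g \<in> Hom paracyclic_cat n p" for m n p f g
    using that by (auto simp: paracyclic_cat_def mono_def)
  have i: "id \<in> Hom paracyclic_cat n n" for n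
    by (simp add: paracyclic_cat_def mono_def)
  have H: "Hom cyclic_cat m n = cyclic_class m n ` Hom paracyclic_cat m n"
    "Ident cyclic_cat n = cyclic_class n n id" for m n
    by (simp_all add: cyclic_cat_def)
  show ?thesis
    unfolding is_category_def H
    by (auto simp: cyclic_Comp cl i comp_assoc intro: imageI)
qed

text \<open>A paracyclic set factors through the cyclic category in at most one way.\<close>

lemma precomp_cyclic_class_inject:
  assumes "cyclic_set X" "cyclic_set Y"
    and eq: "precomp (op_cat paracyclic_cat) (op_functor cyclic_class) X =
      precomp (op_cat paracyclic_cat) (op_functor cyclic_class) Y"
  shows "X = Y"
proof -
  have ob: "Ob X = Ob Y" using eq by (simp add: precomp_def)
  have ar: "Ar X m n (cyclic_class n m f) = Ar Y m n (cyclic_class n m f)"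
    if "f \<in> Hom paracyclic_cat n m" for m n f
    using eq that by (auto simp: precomp_def op_cat_def op_functor_def fun_eq_iff split: if_splits)
  have "Ar X m n A = Ar Y m n A" for m n A
  proof (cases "A \<in> Hom cyclic_cat n m")
    case True
    then show ?thesis using ar by (auto simp: cyclic_cat_def)
  next
    case False
    then show ?thesis using assms(1,2) by (simp add: is_set_functor_def op_cat_def)
  qed
  with ob show ?thesis by (auto intro!: set_functor.equality ext)
qed

subsection \<open>The functor from the opposite cyclic category to \<open>Phi\<close>\<close>

lemma left_adjoint_le:
  assumes f: "f \<in> Hom paracyclic_cat m n"
  shows "left_adjoint f k \<le> j \<longleftrightarrow> k \<le> f j"
proof -
  have mo: "f x \<le> f y" if "x \<le> y" for x y
    using f that by (auto simp: paracyclic_cat_def mono_def)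
  define t where "t = \<bar>k\<bar> + \<bar>f 0\<bar> + 1"
  have t0: "t \<ge> 0" by (simp add: t_def)
  have tn: "t \<le> t * (int n + 1)" using t0 by (simp add: algebra_simps)
  have up: "k \<le> f (t * (int m + 1))"
  proof -
    have "k \<le> f 0 + t" by (simp add: t_def)
    then show ?thesis using paracyclic_shift[OF f, of 0 t] tn by simp
  qed
  have "f (- t * (int m + 1)) = f 0 + - t * (int n + 1)"
    using paracyclic_shift[OF f, of 0 "- t"] by simp
  moreover have "f 0 - t < k" by (simp add: t_def)
  ultimately have low: "f (- t * (int m + 1)) < k" using tn by simp
  have lower: "- t * (int m + 1) < j" if "k \<le> f j" for j
    using mo[of j "- t * (int m + 1)"] low that by linarith
  define b where "b = - t * (int m + 1)"
  obtain l where l: "k \<le> f l" "\<forall>j. k \<le> f j \<longrightarrow> nat (l - b) \<le> nat (j - b)"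
    using ex_has_least_nat[of "\<lambda>j. k \<le> f j" _ "\<lambda>j. nat (j - b)"] up by blast
  have least: "l \<le> j" if "k \<le> f j" for j
    using l(2) that lower[OF that] unfolding b_def[symmetric] by fastforce
  have "left_adjoint f k = l"
    unfolding left_adjoint_def using l(1) least by (intro Least_equality) auto
  then show ?thesis using l(1) least mo[of l j] by auto
qed

lemma left_adjoint_eqI:
  assumes f: "f \<in> Hom paracyclic_cat m n" and "k \<le> f j" "f (j - 1) < k"
  shows "left_adjoint f k = j"
  using left_adjoint_le[OF f, of k j] left_adjoint_le[OF f, of k "j - 1"] assms(2,3) by linarith

lemma left_adjoint_shift:
  assumes f: "f \<in> Hom paracyclic_cat m n"
  shows "left_adjoint f (k + t * (int n + 1)) = left_adjoint f k + t * (int m + 1)"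
proof -
  let ?l = "left_adjoint f k"
  have "k \<le> f ?l" "f (?l - 1) < k"
    using left_adjoint_le[OF f, of k ?l] left_adjoint_le[OF f, of k "?l - 1"] by auto
  then show ?thesis
    using paracyclic_shift[OF f, of ?l t] paracyclic_shift[OF f, of "?l - 1" t]
    by (intro left_adjoint_eqI[OF f]) (auto simp: algebra_simps)
qed

lemma left_adjoint_comp:
  assumes f: "f \<in> Hom paracyclic_cat m n" and g: "g \<in> Hom paracyclic_cat n p"
  shows "left_adjoint (g \<circ> f) k = left_adjoint f (left_adjoint g k)"
proof -
  have "g \<circ> f \<in> Hom paracyclic_cat m p"
    using f g by (auto simp: paracyclic_cat_def mono_def)
  then have "left_adjoint (g \<circ> f) k \<le> j \<longleftrightarrow> left_adjoint f (left_adjoint g k) \<le> j" for j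
    by (simp add: left_adjoint_le[OF f] left_adjoint_le[OF g] left_adjoint_le)
  then show ?thesis by (meson order_antisym order_refl)
qed

text \<open>The value does not depend on the chosen representative.\<close>

lemma cyclic_to_Phi_class:
  assumes f: "f \<in> Hom paracyclic_cat m n"
  shows "cyclic_to_Phi n m (cyclic_class m n f) =
    (\<lambda>k\<in>{..n}. nat (left_adjoint f (int k) mod (int m + 1)))"
proof -
  define g where "g = (SOME g. g \<in> cyclic_class m n f)"
  have "g \<in> cyclic_class m n f"
    unfolding g_def by (rule someI[of "\<lambda>g. g \<in> cyclic_class m n f"]) (rule cyclic_class_self[OF f])
  then have "cyclic_cong m n f g" by (simp add: cyclic_class_def)
  then obtain t where g: "g \<in> Hom paracyclic_cat m n" and t: "\<forall>x. g x = f x + t * (int n + 1)"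
    using cyclic_cong_shift by blast
  have "left_adjoint g k = left_adjoint f (k + (- t) * (int n + 1))" for k
  proof -
    have "left_adjoint g k \<le> j \<longleftrightarrow> left_adjoint f (k + (- t) * (int n + 1)) \<le> j" for j
      using t by (auto simp: left_adjoint_le[OF f] left_adjoint_le[OF g] algebra_simps)
    then show ?thesis by (meson order_antisym order_refl)
  qed
  then have "left_adjoint g k mod (int m + 1) = left_adjoint f k mod (int m + 1)" for k
    by (simp only: left_adjoint_shift[OF f] mod_mult_self1)
  then show ?thesis
    unfolding cyclic_to_Phi_def g_def[symmetric] by simp
qed

lemma functor_cyclic_to_Phi: "is_functor (op_cat cyclic_cat) Phi cyclic_to_Phi"
  unfolding is_functor_def
proof (intro conjI allI impI)
  fix n m A assume "A \<in> Hom (op_cat cyclic_cat) n m"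
  then obtain f where "f \<in> Hom paracyclic_cat m n" "A = cyclic_class m n f"
    by (auto simp: op_cat_def cyclic_cat_def)
  moreover have "nat (x mod (int m + 1)) \<le> m" for x
    using pos_mod_bound[of "int m + 1" x] by linarith
  ultimately show "cyclic_to_Phi n m A \<in> Hom Phi n m"
    by (auto simp: cyclic_to_Phi_class Phi_def)
next
  fix n
  have i: "id \<in> Hom paracyclic_cat n n" by (simp add: paracyclic_cat_def mono_def)
  have "left_adjoint id k = k" for k
    by (rule left_adjoint_eqI[OF i]) auto
  then show "cyclic_to_Phi n n (Ident (op_cat cyclic_cat) n) = Ident Phi n"
    using cyclic_to_Phi_class[OF i] by (auto simp: op_cat_def cyclic_cat_def Phi_def)
next
  fix p n m G F
  assume "G \<in> Hom (op_cat cyclic_cat) p n" "F \<in> Hom (op_cat cyclic_cat) n m"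
  then obtain f g where f: "f \<in> Hom paracyclic_cat m n" "F = cyclic_class m n f"
    and g: "g \<in> Hom paracyclic_cat n p" "G = cyclic_class n p g"
    by (auto simp: op_cat_def cyclic_cat_def)
  have gf: "g \<circ> f \<in> Hom paracyclic_cat m p"
    using f g by (auto simp: paracyclic_cat_def mono_def)
  have C: "Comp (op_cat cyclic_cat) p n m F G = cyclic_class m p (g \<circ> f)"
    using f g cyclic_Comp[of f m n g p] by (simp add: op_cat_def)
  have r: "nat (x mod (int n + 1)) \<le> n" for x
    using pos_mod_bound[of "int n + 1" x] by linarith
  have "left_adjoint f (y mod (int n + 1)) mod (int m + 1) = left_adjoint f y mod (int m + 1)" for y
  proof -
    have "left_adjoint f y = left_adjoint f (y mod (int n + 1) + (y div (int n + 1)) * (int n + 1))"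
      by (simp only: mod_div_mult_eq)
    then show ?thesis by (simp only: left_adjoint_shift[OF f(1)] mod_mult_self1)
  qed
  then have "cyclic_to_Phi p m (cyclic_class m p (g \<circ> f)) =
      Comp Phi p n m (cyclic_to_Phi n m F) (cyclic_to_Phi p n G)"
    using r unfolding cyclic_to_Phi_class[OF gf] f(2) g(2)
      cyclic_to_Phi_class[OF f(1)] cyclic_to_Phi_class[OF g(1)]
    by (auto simp: Phi_def compose_def left_adjoint_comp[OF f(1) g(1)] fun_eq_iff)
  then show "cyclic_to_Phi p m (Comp (op_cat cyclic_cat) p n m F G) =
      Comp Phi p n m (cyclic_to_Phi n m F) (cyclic_to_Phi p n G)"
    by (simp only: C)
qed

lemma cyclic_to_Phi_rotation:
  "cyclic_to_Phi n n (cyclic_class n n rotation) = (\<lambda>k\<in>{..n}. if k = 0 then n else k - 1)"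
proof -
  have "left_adjoint rotation k = k - 1" for k
    by (rule left_adjoint_eqI[OF rotation_Hom]) (auto simp: rotation_def)
  moreover have "(- 1) mod (int n + 1) = int n"
    using zmod_minus1[of "int n + 1"] by simp
  moreover have "nat ((int k - 1) mod (int n + 1)) = k - 1" if "0 < k" "k \<le> n" for k
    using that by (simp add: mod_pos_pos_trivial)
  ultimately show ?thesis
    by (auto simp: cyclic_to_Phi_class[OF rotation_Hom] restrict_def fun_eq_iff)
qed

subsection \<open>The functor \<open>Cut\<close>\<close>

lemma cyclic_to_Phi_simplex_extend:
  assumes f: "f \<in> Hom simplex_cat m n"
  shows "cyclic_to_Phi n m (cyclic_class m n (simplex_extend m n f)) = incl n m (Cut n m f)"
proof -
  note e = simplex_extend_Hom[OF f]
  have mo: "f k \<le> f l" if "k \<le> l" "l \<le> m" for k l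
    using f that by (auto simp: simplex_cat_def mono_on_def)
  have bd: "f k \<le> n" if "k \<le> m" for k
    using f that by (auto simp: simplex_cat_def)
  have last: "simplex_extend m n f (- 1) = int (f m) - (int n + 1)"
    using paracyclic_shift[OF e, of "int m" "- 1"] by (simp add: simplex_extend_small)
  have nxt: "simplex_extend m n f (int m + 1) = int (f 0) + (int n + 1)"
    using paracyclic_shift[OF e, of "0" "1"] simplex_extend_small[of 0 m n f] by simp
  have "nat (left_adjoint (simplex_extend m n f) (int k) mod (int m + 1)) =
      (if \<exists>j\<le>m. k \<le> f j then LEAST j. j \<le> m \<and> k \<le> f j else 0)" if k: "k \<le> n" for k
  proof (cases "\<exists>j\<le>m. k \<le> f j")
    case True
    define l where "l = (LEAST j. j \<le> m \<and> k \<le> f j)"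
    have l: "l \<le> m" "k \<le> f l"
      unfolding l_def using True LeastI_ex[of "\<lambda>j. j \<le> m \<and> k \<le> f j"] by auto
    have "simplex_extend m n f (int l - 1) < int k"
    proof (cases l)
      case 0
      then show ?thesis using last bd[of m] by simp
    next
      case (Suc l')
      then have "\<not> (l' \<le> m \<and> k \<le> f l')"
        unfolding l_def by (intro not_less_Least) simp
      then show ?thesis using Suc l simplex_extend_small[of l' m n f] by auto
    qed
    then have "left_adjoint (simplex_extend m n f) (int k) = int l"
      using l by (intro left_adjoint_eqI[OF e]) (auto simp: simplex_extend_small)
    then show ?thesis using True l(1) unfolding l_def[symmetric] by simp
  next
    case False
    then have "left_adjoint (simplex_extend m n f) (int k) = int m + 1"
      using k nxt by (intro left_adjoint_eqI[OF e]) (auto simp: simplex_extend_small not_le)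
    then show ?thesis by (simp add: if_not_P[OF False])
  qed
  then show ?thesis
    by (auto simp: cyclic_to_Phi_class[OF e] Cut_def incl_def restrict_def fun_eq_iff)
qed

lemma functor_Cut: "is_functor (op_cat simplex_cat) Phi_pointed Cut"
proof -
  have Cut: "Cut n m f = cyclic_to_Phi n m (cyclic_class m n (simplex_extend m n f))"
    if "f \<in> Hom simplex_cat m n" for m n f
    using cyclic_to_Phi_simplex_extend[OF that] by (simp add: incl_def)
  have h: "cyclic_class m n (simplex_extend m n f) \<in> Hom (op_cat cyclic_cat) n m"
    if "f \<in> Hom simplex_cat m n" for m n f
    using simplex_extend_Hom[OF that] by (simp add: op_cat_def cyclic_cat_def)
  note F = functor_cyclic_to_Phi[unfolded is_functor_def]
  show ?thesis
    unfolding is_functor_def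
  proof (intro conjI allI impI)
    fix n m f assume "f \<in> Hom (op_cat simplex_cat) n m"
    then have f: "f \<in> Hom simplex_cat m n" by (simp add: op_cat_def)
    have "Cut n m f \<in> Hom Phi n m" using F h[OF f] Cut[OF f] by metis
    moreover have "Cut n m f 0 = 0" by (auto simp: Cut_def intro: Least_equality)
    ultimately show "Cut n m f \<in> Hom Phi_pointed n m"
      by (simp add: Phi_def Phi_pointed_def)
  next
    fix n
    show "Cut n n (Ident (op_cat simplex_cat) n) = Ident Phi_pointed n"
      by (auto simp: Cut_def op_cat_def simplex_cat_def Phi_def Phi_pointed_def restrict_def fun_eq_iff
          intro!: Least_equality)
  next
    fix p n m g f
    assume "g \<in> Hom (op_cat simplex_cat) p n" "f \<in> Hom (op_cat simplex_cat) n m"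
    then have f: "f \<in> Hom simplex_cat m n" and g: "g \<in> Hom simplex_cat n p"
      by (simp_all add: op_cat_def)
    have gf: "Comp simplex_cat m n p g f \<in> Hom simplex_cat m p"
      using category_simplex f g unfolding is_category_def by blast
    have "cyclic_class m p (simplex_extend m p (Comp simplex_cat m n p g f)) =
        Comp (op_cat cyclic_cat) p n m (cyclic_class m n (simplex_extend m n f)) (cyclic_class n p (simplex_extend n p g))"
      using functor_simplex_extend functor_cyclic_class f g simplex_extend_Hom[OF f] simplex_extend_Hom[OF g]
      unfolding is_functor_def by (simp add: op_cat_def)
    then show "Cut p m (Comp (op_cat simplex_cat) p n m f g) =
        Comp Phi_pointed p n m (Cut n m f) (Cut p n g)"
      using F h[OF f] h[OF g] Cut[OF f] Cut[OF g] Cut[OF gf]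
      by (simp add: op_cat_def Phi_pointed_def Phi_def)
  qed
qed

lemma Cut_eqI:
  assumes "k \<le> n" "j \<le> m" "k \<le> f j" "\<And>i. i < j \<Longrightarrow> f i < k"
  shows "Cut n m f k = j"
proof -
  have "(LEAST j. j \<le> m \<and> k \<le> f j) = j"
    using assms(2-4) by (intro Least_equality) (auto simp: not_less[symmetric])
  then show ?thesis using assms(1-3) by (auto simp: Cut_def)
qed

lemma Cut_eq_0:
  assumes "k \<le> n" "\<And>i. i \<le> m \<Longrightarrow> f i < k"
  shows "Cut n m f k = 0"
  using assms by (auto simp: Cut_def not_le[symmetric])

lemma Cut_outside: "\<not> k \<le> n \<Longrightarrow> Cut n m f k = undefined"
  by (simp add: Cut_def)

lemma Cut_coface_less:
  assumes "i < n"
  shows "Cut n (n - 1) (coface n i) = (\<lambda>k\<in>{..n}. if k \<le> i then k else k - 1)"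
proof
  fix k
  show "Cut n (n - 1) (coface n i) k = (\<lambda>k\<in>{..n}. if k \<le> i then k else k - 1) k"
  proof (cases "k \<le> n")
    case True
    have "Cut n (n - 1) (coface n i) k = (if k \<le> i then k else k - 1)"
      using True assms by (intro Cut_eqI) (auto simp: coface_def split: if_splits)
    then show ?thesis using True by simp
  qed (simp add: Cut_outside)
qed

lemma Cut_coface_last:
  assumes "0 < n"
  shows "Cut n (n - 1) (coface n n) = (\<lambda>k\<in>{..n}. if k < n then k else 0)"
proof
  fix k
  consider "k < n" | "k = n" | "\<not> k \<le> n" by linarith
  then show "Cut n (n - 1) (coface n n) k = (\<lambda>k\<in>{..n}. if k < n then k else 0) k"
  proof cases
    case 1
    then have "Cut n (n - 1) (coface n n) k = k"
      by (intro Cut_eqI) (auto simp: coface_def)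
    then show ?thesis using 1 by simp
  next
    case 2
    then have "Cut n (n - 1) (coface n n) k = 0"
      using assms by (intro Cut_eq_0) (auto simp: coface_def)
    then show ?thesis using 2 by simp
  qed (simp add: Cut_outside)
qed

lemma Cut_codegeneracy:
  assumes "i \<le> n"
  shows "Cut n (n + 1) (codegeneracy n i) = (\<lambda>k\<in>{..n}. if k \<le> i then k else k + 1)"
proof
  fix k
  show "Cut n (n + 1) (codegeneracy n i) k = (\<lambda>k\<in>{..n}. if k \<le> i then k else k + 1) k"
  proof (cases "k \<le> n")
    case True
    have "Cut n (n + 1) (codegeneracy n i) k = (if k \<le> i then k else k + 1)"
      using True assms by (intro Cut_eqI) (auto simp: codegeneracy_def split: if_splits)
    then show ?thesis using True by simp
  qed (simp add: Cut_outside)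
qed

end

theory Submission
  imports Defs
begin

text \<open>Regard the elements of \<open>X\<^sub>n\<close> as \<open>(n + 1)\<close>-gons. Inserting a degenerate side gives an injection
  \<open>R\<^sub>n : X\<^sub>n \<rightarrow> X\<^sub>n\<^sub>+\<^sub>1\<close> with \<open>d\<^sub>n\<^sub>+\<^sub>1 R\<^sub>n = id\<close> and \<open>d\<^sub>0 R\<^sub>n = \<tau>\<^sup>n\<close>, after which the \<open>n + 1\<close> old sides are exactly the
  non-basepoint elements on which the \<open>\<Gamma>\<close>-structure of \<open>X\<^sub>n\<^sub>+\<^sub>1\<close> acts. Since 2-Segal sets are unital, the
  image of \<open>R\<^sub>n\<close> consists of all elements whose long edge lies in the image of \<open>R\<^sub>0\<close>; this is preserved
  by every pointed map \<open>f\<^sub>+\<close> obtained by adding a basepoint to a map \<open>f : [m] \<rightarrow> [n]\<close>. Hence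
  \<open>F f = d\<^sub>n\<^sub>+\<^sub>1 Q(f\<^sub>+) R\<^sub>m\<close> is functorial. It extends \<open>Q\<close> because of \<open>d\<^sub>n\<^sub>+\<^sub>1 f\<^sub>+ = f d\<^sub>m\<^sub>+\<^sub>1\<close> for pointed \<open>f\<close>, and it
  sends the cyclic permutation to \<open>d\<^sub>0 R\<^sub>n = \<tau>\<^sup>n\<close>. So \<open>P\<close> factors through \<open>F\<close>, and in particular it is cyclic.\<close>

section \<open>Set-valued functors\<close>

lemma set_functor_into:
  assumes "is_set_functor C X" "f \<in> Hom C m n" "x \<in> Ob X m"
  shows "Ar X m n f x \<in> Ob X n"
  using assms unfolding is_set_functor_def by (metis PiE_mem)

lemma set_functor_Ident:
  assumes "is_set_functor C X" "x \<in> Ob X n"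
  shows "Ar X n n (Ident C n) x = x"
  using assms by (simp add: is_set_functor_def)

lemma set_functor_Comp:
  assumes "is_set_functor C X" "f \<in> Hom C m n" "g \<in> Hom C n p" "x \<in> Ob X m"
  shows "Ar X m p (Comp C m n p g f) x = Ar X n p g (Ar X m n f x)"
  using assms by (simp add: is_set_functor_def compose_def)

text \<open>Because action maps are extensional and \<open>Ar\<close> is \<open>undefined\<close>
  off the arrows, equality of records reduces to values on elements.\<close>

lemma set_functor_eqI:
  assumes X: "is_set_functor C X" and Y: "is_set_functor C Y"
    and ob: "Ob X = Ob Y"
    and ar: "\<And>m n f x. f \<in> Hom C m n \<Longrightarrow> x \<in> Ob X m \<Longrightarrow> Ar X m n f x = Ar Y m n f x"
  shows "X = Y"
proof -
  have "Ar X m n f = Ar Y m n f" for m n f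
  proof (cases "f \<in> Hom C m n")
    case True
    then have "Ar X m n f \<in> Ob X m \<rightarrow>\<^sub>E Ob X n" "Ar Y m n f \<in> Ob X m \<rightarrow>\<^sub>E Ob X n"
      using X Y ob by (auto simp: is_set_functor_def)
    then show ?thesis using ar[OF True] by (rule PiE_ext)
  qed (use X Y in \<open>simp add: is_set_functor_def\<close>)
  with ob show ?thesis by (auto intro!: set_functor.equality ext)
qed

lemma Ob_precomp [simp]: "Ob (precomp C \<phi> X) = Ob X"
  by (simp add: precomp_def)

lemma Ar_precomp: "f \<in> Hom C m n \<Longrightarrow> Ar (precomp C \<phi> X) m n f = Ar X m n (\<phi> m n f)"
  by (simp add: precomp_def)

text \<open>The hypothesis \<open>is_category C\<close> ensures that identities and composites are
  arrows, where \<open>precomp\<close> is not \<open>undefined\<close>.\<close>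

lemma set_functor_precomp:
  assumes C: "is_category C" and \<phi>: "is_functor C D \<phi>" and X: "is_set_functor D X"
  shows "is_set_functor C (precomp C \<phi> X)"
proof -
  have "Comp C m n p g f \<in> Hom C m p" if "f \<in> Hom C m n" "g \<in> Hom C n p" for m n p f g
    using C that unfolding is_category_def by blast
  moreover have "Ident C n \<in> Hom C n n" for n
    using C unfolding is_category_def by blast
  ultimately show ?thesis
    using \<phi> X by (simp add: is_set_functor_def is_functor_def precomp_def)
qed

lemma category_op: "is_category C \<Longrightarrow> is_category (op_cat C)"
  unfolding is_category_def op_cat_def by simp

lemma functor_op: "is_functor C D \<phi> \<Longrightarrow> is_functor (op_cat C) (op_cat D) (op_functor \<phi>)"
  by (simp add: is_functor_def op_cat_def op_functor_def)

section \<open>Unitality of 2-Segal sets\<close>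

lemma simplex_Hom: "f \<in> Hom simplex_cat m n \<longleftrightarrow> f \<in> {..m} \<rightarrow>\<^sub>E {..n} \<and> mono_on {..m} f"
  by (simp add: simplex_cat_def)

lemma coface_Hom: "coface (Suc n) i \<in> Hom simplex_cat n (Suc n)"
  by (auto simp: simplex_Hom coface_def mono_on_def)

lemma codegeneracy_Hom: "i \<le> n \<Longrightarrow> codegeneracy n i \<in> Hom simplex_cat (Suc n) n"
  by (auto simp: simplex_Hom codegeneracy_def mono_on_def)

text \<open>The target does not enter the formula, so one function serves as an arrow into every
  larger object. Under it, \<open>initial 1\<close> picks out the edge 01 and
  \<open>initial 0\<close> the vertex 0.\<close>

definition initial :: "nat \<Rightarrow> nat \<Rightarrow> nat" where
  "initial m = (\<lambda>k\<in>{..m}. k)"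

lemma initial_Hom: "m \<le> n \<Longrightarrow> initial m \<in> Hom simplex_cat m n"
  by (auto simp: initial_def simplex_Hom mono_on_def)

lemma simplicial_into:
  assumes "simplicial_set X" "f \<in> Hom simplex_cat m n" "x \<in> Ob X n"
  shows "Ar X n m f x \<in> Ob X m"
  using set_functor_into[OF assms(1)] assms(2,3) by (simp add: op_cat_def)

lemma simplicial_comp:
  assumes "simplicial_set X" "f \<in> Hom simplex_cat m n" "g \<in> Hom simplex_cat n p" "x \<in> Ob X p"
  shows "Ar X n m f (Ar X p n g x) = Ar X p m (compose {..m} g f) x"
  using set_functor_Comp[OF assms(1), of g p n f m x] assms(2-4)
  by (simp add: op_cat_def simplex_cat_def)

lemma simplicial_ident:
  assumes "simplicial_set X" "x \<in> Ob X n"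
  shows "Ar X n n (\<lambda>k\<in>{..n}. k) x = x"
  using set_functor_Ident[OF assms] by (simp add: op_cat_def simplex_cat_def)

text \<open>If the edge \<open>01\<close> of \<open>u\<close> is degenerate, then \<open>s\<^sub>0 u\<close> and \<open>s\<^sub>1 u\<close> have the same image under the
  2-Segal map \<open>(d\<^sub>1, d\<^sub>n\<^sub>+\<^sub>1)\<close>, so \<open>u = d\<^sub>2 s\<^sub>1 u = d\<^sub>2 s\<^sub>0 u = s\<^sub>0 d\<^sub>1 u\<close>.\<close>

lemma two_segal_degenerate:
  assumes X: "simplicial_set X" and S: "two_segal X"
    and "u \<in> Ob X (Suc n)"
    and "Ar X (Suc n) 1 (initial 1) u \<in> Ar X 0 1 (codegeneracy 0 0) ` Ob X 0"
  shows "u \<in> Ar X n (Suc n) (codegeneracy n 0) ` Ob X n"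
  using assms(3,4)
proof (induction n arbitrary: u)
  \<comment> \<open>Here \<open>initial 1\<close> is the identity of \<open>[1]\<close>, so the
    assumption on the edge 01 is already the claim.\<close>
  case 0
  then show ?case using simplicial_ident[OF X 0(1)] by (simp flip: initial_def)
next
  case (Suc n)
  let ?N = "Suc (Suc n)"
  note into = simplicial_into[OF X] and comp = simplicial_comp[OF X]
  note H = coface_Hom codegeneracy_Hom
  have u: "u \<in> Ob X ?N" by fact
  \<comment> \<open>The last face keeps the edge 01, so the induction hypothesis makes it a
    degeneracy \<open>s_0 w\<close>. This gives \<open>s_0 d = s_1 d\<close>, the second coordinate
    needed for the 2-Segal map.\<close>
  define d where "d = Ar X ?N (Suc n) (coface ?N ?N) u"
  have d: "d \<in> Ob X (Suc n)" unfolding d_def by (intro into H u)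
  have "compose {..1} (coface ?N ?N) (initial 1) = initial 1"
    by (auto simp: initial_def compose_def coface_def fun_eq_iff)
  then have "Ar X (Suc n) 1 (initial 1) d = Ar X ?N 1 (initial 1) u"
    unfolding d_def by (subst comp[OF initial_Hom H(1) u]) simp_all
  then obtain w where w: "w \<in> Ob X n" "d = Ar X n (Suc n) (codegeneracy n 0) w"
    using Suc.IH[OF d] Suc.prems(2) by auto
  have dd: "Ar X (Suc n) ?N (codegeneracy (Suc n) 0) d = Ar X (Suc n) ?N (codegeneracy (Suc n) 1) d"
  proof -
    have "compose {..?N} (codegeneracy n 0) (codegeneracy (Suc n) 0) =
      compose {..?N} (codegeneracy n 0) (codegeneracy (Suc n) 1)"
      by (auto simp: compose_def codegeneracy_def fun_eq_iff)
    then show ?thesis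
      unfolding w(2) by (simp add: comp[OF H(2) H(2) w(1)])
  qed
  define s where "s i = Ar X ?N (Suc ?N) (codegeneracy ?N i) u" for i
  have s: "s i \<in> Ob X (Suc ?N)" if "i \<le> 1" for i
    unfolding s_def using that by (intro into H u) simp
  have ds: "Ar X (Suc ?N) ?N (coface (Suc ?N) j) (s i) =
      Ar X ?N ?N (compose {..?N} (codegeneracy ?N i) (coface (Suc ?N) j)) u" if "i \<le> 1" for i j
    unfolding s_def using that by (intro comp H u) simp
  have d1: "Ar X (Suc ?N) ?N (coface (Suc ?N) 1) (s i) = u" if "i \<le> 1" for i
  proof -
    have "compose {..?N} (codegeneracy ?N i) (coface (Suc ?N) 1) = (\<lambda>k\<in>{..?N}. k)"
      using that by (auto simp: compose_def codegeneracy_def coface_def fun_eq_iff)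
    then show ?thesis using ds[OF that, of 1] simplicial_ident[OF X u] by simp
  qed
  have dN: "Ar X (Suc ?N) ?N (coface (Suc ?N) (Suc ?N)) (s i) =
      Ar X (Suc n) ?N (codegeneracy (Suc n) i) d" if "i \<le> 1" for i
  proof -
    have "compose {..?N} (codegeneracy ?N i) (coface (Suc ?N) (Suc ?N)) =
        compose {..?N} (coface ?N ?N) (codegeneracy (Suc n) i)"
      using that by (auto simp: compose_def codegeneracy_def coface_def fun_eq_iff)
    moreover have "Ar X (Suc n) ?N (codegeneracy (Suc n) i) d =
        Ar X ?N ?N (compose {..?N} (coface ?N ?N) (codegeneracy (Suc n) i)) u"
      unfolding d_def using that by (intro comp H u) simp
    ultimately show ?thesis using ds[OF that] by simp
  qed
  \<comment> \<open>This is the second 2-Segal square with \<open>i = 1\<close>. It requires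
    \<open>1 < ?N\<close>, hence the separate base case.\<close>
  have "inj_on (\<lambda>x. (face X (?N + 1) 1 x, face X (?N + 1) (?N + 1) x)) (Ob X (?N + 1))"
    using S unfolding two_segal_def bij_betw_def by force
  moreover have "face X (?N + 1) 1 (s 0) = face X (?N + 1) 1 (s 1)"
    using d1[of 0] d1[of 1] by (simp add: face_def)
  moreover have "face X (?N + 1) (?N + 1) (s 0) = face X (?N + 1) (?N + 1) (s 1)"
    using dN[of 0] dN[of 1] dd by (simp add: face_def)
  ultimately have s01: "s 0 = s 1"
    using s[of 0] s[of 1] by (auto dest: inj_onD)
  have "compose {..?N} (codegeneracy ?N 1) (coface (Suc ?N) 2) = (\<lambda>k\<in>{..?N}. k)"
    by (auto simp: compose_def codegeneracy_def coface_def fun_eq_iff)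
  then have "u = Ar X (Suc ?N) ?N (coface (Suc ?N) 2) (s 0)"
    using ds[of 1 2] simplicial_ident[OF X u] s01 by simp
  also have "\<dots> = Ar X ?N ?N (compose {..?N} (coface ?N 1) (codegeneracy (Suc n) 0)) u"
  proof -
    have "compose {..?N} (codegeneracy ?N 0) (coface (Suc ?N) 2) =
        compose {..?N} (coface ?N 1) (codegeneracy (Suc n) 0)"
      by (auto simp: compose_def codegeneracy_def coface_def fun_eq_iff)
    then show ?thesis using ds[of 0 2] by simp
  qed
  also have "\<dots> = Ar X (Suc n) ?N (codegeneracy (Suc n) 0) (Ar X ?N (Suc n) (coface ?N 1) u)"
    by (intro comp[symmetric] H u) simp
  finally show ?case using into[OF H(1) u] by blast
qed

section \<open>The paracyclic category\<close>

lemma paracyclic_Hom: "f \<in> Hom paracyclic_cat m n \<longleftrightarrow>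
    mono f \<and> (\<forall>x. f (x + int m + 1) = f x + int n + 1)"
  by (simp add: paracyclic_cat_def)

lemma paracyclic_Hom_comp:
  "f \<in> Hom paracyclic_cat m n \<Longrightarrow> g \<in> Hom paracyclic_cat n p \<Longrightarrow> g \<circ> f \<in> Hom paracyclic_cat m p"
  by (auto simp: paracyclic_Hom mono_def)

lemma paracyclic_eqI:
  assumes f: "f \<in> Hom paracyclic_cat m n" and g: "g \<in> Hom paracyclic_cat m n"
    and eq: "\<And>k. k \<le> m \<Longrightarrow> f (int k) = g (int k)"
  shows "f = g"
proof
  fix x
  let ?r = "x mod (int m + 1)"
  have "0 \<le> ?r" "?r \<le> int m"
    using pos_mod_bound[of "int m + 1" x] by auto
  then have "f ?r = g ?r"
    using eq[of "nat ?r"] by (simp add: nat_le_iff)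
  then have "f (?r + (x div (int m + 1)) * (int m + 1)) = g (?r + (x div (int m + 1)) * (int m + 1))"
    by (simp only: paracyclic_shift[OF f] paracyclic_shift[OF g])
  then show "f x = g x" by (simp only: mod_div_mult_eq)
qed

lemma shift_Hom: "(\<lambda>x. x + a) \<in> Hom paracyclic_cat n n"
  by (simp add: paracyclic_Hom mono_def)

lemma paracyclic_into:
  assumes "paracyclic_set P" "f \<in> Hom paracyclic_cat m n" "x \<in> Ob P n"
  shows "Ar P n m f x \<in> Ob P m"
  using set_functor_into[OF assms(1)] assms(2,3) by (simp add: op_cat_def)

lemma paracyclic_comp:
  assumes "paracyclic_set P" "f \<in> Hom paracyclic_cat m n" "g \<in> Hom paracyclic_cat n p" "x \<in> Ob P p"
  shows "Ar P n m f (Ar P p n g x) = Ar P p m (g \<circ> f) x"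
  using set_functor_Comp[OF assms(1), of g p n f m x] assms(2-4)
  by (simp add: op_cat_def paracyclic_cat_def)

lemma paracyclic_ident: "paracyclic_set P \<Longrightarrow> x \<in> Ob P n \<Longrightarrow> Ar P n n id x = x"
  using set_functor_Ident[of "op_cat paracyclic_cat" P x n] by (simp add: op_cat_def paracyclic_cat_def)

section \<open>Generation of paracyclic arrows by simplicial arrows and rotations\<close>

text \<open>Shifting the source by the least integer \<open>j\<close> with
  \<open>0 \<le> f j\<close> gives \<open>h\<close> with \<open>h (- 1) < 0 \<le> h 0\<close>.
  Periodicity yields \<open>h m = h (- 1) + n + 1 \<le> n\<close>, so \<open>h\<close> maps
  \<open>{0..m}\<close> into \<open>{0..n}\<close> and is simplicial. The shift in the conclusion is
  the inverse one.\<close>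

lemma paracyclic_factor:
  assumes f: "f \<in> Hom paracyclic_cat m n"
  obtains g j where "g \<in> Hom simplex_cat m n" "f = simplex_extend m n g \<circ> (\<lambda>x. x + j)"
proof -
  define j where "j = left_adjoint f 0"
  define h where "h = f \<circ> (\<lambda>x. x + j)"
  have h: "h \<in> Hom paracyclic_cat m n"
    unfolding h_def by (rule paracyclic_Hom_comp[OF shift_Hom f])
  then have mo: "h x \<le> h y" if "x \<le> y" for x y
    using that by (auto simp: paracyclic_Hom mono_def)
  have "0 \<le> h 0" "h (- 1) < 0"
    using left_adjoint_le[OF f, of 0 j] left_adjoint_le[OF f, of 0 "j - 1"]
    by (auto simp: h_def j_def)
  moreover have "h (int m) = h (- 1) + int n + 1"
    using h by (simp add: paracyclic_Hom) (metis add.left_commute add_0_right add_neg_numeral_special(7))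
  ultimately have b: "0 \<le> h (int k) \<and> h (int k) \<le> int n" if "k \<le> m" for k
    using that mo[of 0 "int k"] mo[of "int k" "int m"] by auto
  let ?g = "\<lambda>k\<in>{..m}. nat (h (int k))"
  have "h = simplex_extend m n ?g"
    using h b by (intro simplex_extend_unique) auto
  moreover have "?g \<in> Hom simplex_cat m n"
    using b mo by (auto simp: simplex_Hom mono_on_def nat_le_iff intro: nat_mono)
  moreover have "f = h \<circ> (\<lambda>x. x + (- j))" by (simp add: h_def fun_eq_iff)
  ultimately show ?thesis using that by metis
qed

text \<open>By \<open>paracyclic_factor\<close> every arrow is a simplicial arrow after a shift, and
  shifts are powers of \<open>rotation\<close>.\<close>

lemma paracyclic_set_eqI:
  assumes P: "paracyclic_set P" and P': "paracyclic_set P'" and ob: "Ob P = Ob P'"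
    and simp: "\<And>m n g x. g \<in> Hom simplex_cat m n \<Longrightarrow> x \<in> Ob P n \<Longrightarrow>
      Ar P n m (simplex_extend m n g) x = Ar P' n m (simplex_extend m n g) x"
    and rot: "\<And>n x. x \<in> Ob P n \<Longrightarrow> Ar P n n rotation x = Ar P' n n rotation x"
  shows "P = P'"
proof -
  have pos: "Ar P n n (\<lambda>x. x + int j) x = Ar P' n n (\<lambda>x. x + int j) x" if x: "x \<in> Ob P n" for n j x
  proof (induction j)
    case 0
    then show ?case using paracyclic_ident[OF P x] paracyclic_ident[OF P', of x n] x ob
      by (simp add: id_def)
  next
    case (Suc j)
    have c: "(\<lambda>x. x + int (Suc j)) = (\<lambda>x. x + int j) \<circ> rotation"
      by (auto simp: rotation_def)
    have "Ar P n n (\<lambda>x. x + int j) x \<in> Ob P n" by (rule paracyclic_into[OF P shift_Hom x])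
    then show ?case
      unfolding c using paracyclic_comp[OF P rotation_Hom shift_Hom x, of "int j"]
        paracyclic_comp[OF P' rotation_Hom shift_Hom, of x n "int j"] x ob Suc rot by simp
  qed
  \<comment> \<open>Negative shifts act as inverses of positive ones, on which both actions already
    agree.\<close>
  have neg: "Ar P n n (\<lambda>x. x + (- int j)) x = Ar P' n n (\<lambda>x. x + (- int j)) x"
    if x: "x \<in> Ob P n" for n j x
  proof -
    let ?p = "\<lambda>x. x + int j" and ?m = "\<lambda>x. x + (- int j)"
    have i: "?p \<circ> ?m = id" "?m \<circ> ?p = id" by auto
    have x': "x \<in> Ob P' n" using x ob by simp
    define y where "y = Ar P n n ?m x"
    have y: "y \<in> Ob P n" "y \<in> Ob P' n"
      unfolding y_def ob[symmetric] by (rule paracyclic_into[OF P shift_Hom x])+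
    have "Ar P n n ?p y = x"
      unfolding y_def using paracyclic_comp[OF P shift_Hom shift_Hom x] paracyclic_ident[OF P x] i
      by metis
    then have "Ar P' n n ?p y = x" using pos[OF y(1)] by simp
    then have "Ar P' n n ?m x = y"
      using paracyclic_comp[OF P' shift_Hom shift_Hom y(2)] paracyclic_ident[OF P' y(2)] i
      by metis
    then show ?thesis by (simp add: y_def)
  qed
  have shift: "Ar P n n (\<lambda>x. x + j) x = Ar P' n n (\<lambda>x. x + j) x" if "x \<in> Ob P n" for n j x
    using pos[OF that, of "nat j"] neg[OF that, of "nat (- j)"] by (cases "j \<ge> 0") simp_all
  show ?thesis
  proof (rule set_functor_eqI[OF P P' ob])
    fix n m f x assume "f \<in> Hom (op_cat paracyclic_cat) n m" and x: "x \<in> Ob P n"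
    then obtain g j where g: "g \<in> Hom simplex_cat m n" and f: "f = simplex_extend m n g \<circ> (\<lambda>x. x + j)"
      by (auto simp: op_cat_def elim: paracyclic_factor)
    note e = simplex_extend_Hom[OF g]
    show "Ar P n m f x = Ar P' n m f x"
      unfolding f using paracyclic_comp[OF P shift_Hom e x, of j] paracyclic_comp[OF P' shift_Hom e, of x j]
        simp[OF g x] shift[OF paracyclic_into[OF P e x], of j] x ob by simp
  qed
qed

section \<open>Closing up a polygon\<close>

text \<open>\<open>wrap n\<close> is the map \<open>[n + 1] \<rightarrow> [n]\<close> with \<open>k \<mapsto> k\<close> for \<open>0 \<le> k \<le> n + 1\<close>. It turns an \<open>(n + 1)\<close>-gon
  into an \<open>(n + 2)\<close>-gon whose gaps \<open>1, \<dots>, n + 1\<close> are the old gaps \<open>1, \<dots>, n, 0\<close> and whose gap \<open>0\<close> is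
  degenerate.\<close>

definition wrap :: "nat \<Rightarrow> int \<Rightarrow> int" where
  "wrap n x = x - x div (int n + 2)"

lemma wrap_small: "k \<le> Suc n \<Longrightarrow> wrap n (int k) = int k"
  by (simp add: wrap_def)

text \<open>Monotonicity holds because the quotient by \<open>n + 2\<close> grows by at most one
  when \<open>x\<close> does. Over a full period it grows by exactly one, which turns
  \<open>n + 2\<close> into \<open>n + 1\<close>.\<close>

lemma wrap_Hom: "wrap n \<in> Hom paracyclic_cat (Suc n) n"
proof -
  have *: "(x + (int n + 2)) div (int n + 2) = x div (int n + 2) + 1" for x
    by (rule div_add_self2) simp
  have "wrap n x \<le> wrap n (x + 1)" for x
  proof -
    have "(x + 1) div (int n + 2) \<le> (x + (int n + 2)) div (int n + 2)"
      by (rule zdiv_mono1) auto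
    then show ?thesis by (simp add: * wrap_def)
  qed
  then have "wrap n x \<le> wrap n (x + int k)" for x k
  proof (induction k)
    case (Suc k)
    then show ?case using order_trans[OF Suc.IH[OF Suc.prems] Suc.prems[of "x + int k"]]
      by (simp add: algebra_simps)
  qed simp
  then have "mono (wrap n)" by (metis monoI zle_iff_zadd)
  moreover have "wrap n (x + int (Suc n) + 1) = wrap n x + int n + 1" for x
    using *[of x] by (simp add: wrap_def algebra_simps)
  ultimately show ?thesis by (simp add: paracyclic_Hom)
qed

text \<open>Read contravariantly through \<open>P\<close>, this and the next lemma are
  \<open>d_(n+1) R_n = id\<close> and \<open>d_0 R_n = tau^n\<close>.\<close>

lemma wrap_coface_last: "wrap n \<circ> simplex_extend n (Suc n) (coface (Suc n) (Suc n)) = id"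
proof (rule paracyclic_eqI[where m = n and n = n])
  show "id \<in> Hom paracyclic_cat n n" by (simp add: paracyclic_Hom mono_def)
  show "wrap n \<circ> simplex_extend n (Suc n) (coface (Suc n) (Suc n)) \<in> Hom paracyclic_cat n n"
    by (rule paracyclic_Hom_comp[OF simplex_extend_Hom[OF coface_Hom] wrap_Hom])
qed (simp add: simplex_extend_small coface_def wrap_small)

lemma wrap_coface_0: "wrap n \<circ> simplex_extend n (Suc n) (coface (Suc n) 0) = rotation"
proof (rule paracyclic_eqI[where m = n and n = n])
  show "wrap n \<circ> simplex_extend n (Suc n) (coface (Suc n) 0) \<in> Hom paracyclic_cat n n"
    by (rule paracyclic_Hom_comp[OF simplex_extend_Hom[OF coface_Hom] wrap_Hom])
  fix k assume "k \<le> n"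
  then show "(wrap n \<circ> simplex_extend n (Suc n) (coface (Suc n) 0)) (int k) = rotation (int k)"
    using wrap_small[of "Suc k" n] by (simp add: simplex_extend_small coface_def rotation_def)
qed (rule rotation_Hom)

text \<open>Thus \<open>R_n\<close> is \<open>s_0\<close> followed by a rotation, which lets
  unitality, a statement about the image of \<open>s_0\<close>, describe the image of
  \<open>R_n\<close>.\<close>

lemma wrap_codegeneracy: "wrap n = simplex_extend (Suc n) n (codegeneracy n 0) \<circ> (\<lambda>x. x + 1)"
proof (rule paracyclic_eqI[OF wrap_Hom])
  have e: "simplex_extend (Suc n) n (codegeneracy n 0) \<in> Hom paracyclic_cat (Suc n) n"
    by (intro simplex_extend_Hom codegeneracy_Hom) simp
  show "simplex_extend (Suc n) n (codegeneracy n 0) \<circ> (\<lambda>x. x + 1) \<in> Hom paracyclic_cat (Suc n) n"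
    by (rule paracyclic_Hom_comp[OF shift_Hom e])
  fix k assume k: "k \<le> Suc n"
  show "wrap n (int k) = (simplex_extend (Suc n) n (codegeneracy n 0) \<circ> (\<lambda>x. x + 1)) (int k)"
  proof (cases "k = Suc n")
    \<comment> \<open>The argument \<open>k + 1 = n + 2\<close> starts the next period, so its value
      comes from the one at 0.\<close>
    case True
    have "simplex_extend (Suc n) n (codegeneracy n 0) (2 + int n) = int n + 1"
      using paracyclic_shift[OF e, of 0 1] simplex_extend_small[of 0 "Suc n" n "codegeneracy n 0"]
      by (simp add: codegeneracy_def)
    then show ?thesis using True wrap_small[OF k] by (simp add: add.commute)
  next
    case False
    then have "simplex_extend (Suc n) n (codegeneracy n 0) (int (Suc k)) = int k"
      using k by (subst simplex_extend_small) (auto simp: codegeneracy_def)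
    then show ?thesis using wrap_small[OF k] by (simp add: algebra_simps)
  qed
qed

section \<open>Long edges and the image of \<open>R_n\<close>\<close>

definition long_edge :: "nat \<Rightarrow> nat \<Rightarrow> nat" where
  "long_edge n = (\<lambda>k\<in>{..1}. if k = 0 then 0 else n)"

lemma long_edge_Hom: "long_edge n \<in> Hom simplex_cat 1 n"
  by (auto simp: simplex_Hom long_edge_def mono_on_def)

text \<open>Both sides send 0 to 0 and 1 to \<open>n + 1\<close>. Hence the long edge of
  \<open>R_n w\<close> is \<open>R_0\<close> of the initial vertex of \<open>w\<close>.\<close>

lemma wrap_long_edge:
  "wrap n \<circ> simplex_extend 1 (Suc n) (long_edge (Suc n)) = simplex_extend 0 n (initial 0) \<circ> wrap 0"
proof (rule paracyclic_eqI[where m = 1 and n = n])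
  show "wrap n \<circ> simplex_extend 1 (Suc n) (long_edge (Suc n)) \<in> Hom paracyclic_cat 1 n"
    by (rule paracyclic_Hom_comp[OF simplex_extend_Hom[OF long_edge_Hom] wrap_Hom])
  have e: "simplex_extend 0 n (initial 0) \<in> Hom paracyclic_cat 0 n"
    by (intro simplex_extend_Hom initial_Hom) simp
  then show "simplex_extend 0 n (initial 0) \<circ> wrap 0 \<in> Hom paracyclic_cat 1 n"
    using paracyclic_Hom_comp[OF wrap_Hom[of 0] e] by simp
  fix k :: nat assume "k \<le> 1"
  then consider "k = 0" | "k = 1" by linarith
  then show "(wrap n \<circ> simplex_extend 1 (Suc n) (long_edge (Suc n))) (int k) =
      (simplex_extend 0 n (initial 0) \<circ> wrap 0) (int k)"
  proof cases
    case 1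
    then show ?thesis by (simp add: simplex_extend_def initial_def long_edge_def wrap_def)
  next
    case 2
    then show ?thesis using wrap_small[of "Suc n" n] wrap_small[of 1 0]
      by (simp add: simplex_extend_def initial_def long_edge_def)
  qed
qed

text \<open>Moved back by one, the edge 01 runs from -1 to 0, which is the long edge traversed one
  step earlier in the periodic picture. This trades a condition on the edge 01 for one on the long
  edge.\<close>

lemma long_edge_shift:
  "(\<lambda>x. x + (- 1)) \<circ> simplex_extend 1 (Suc n) (initial 1) =
    simplex_extend 1 (Suc n) (long_edge (Suc n)) \<circ> (\<lambda>x. x + (- 1))"
proof (rule paracyclic_eqI[where m = 1 and n = "Suc n"])
  have e: "simplex_extend 1 (Suc n) (long_edge (Suc n)) \<in> Hom paracyclic_cat 1 (Suc n)"
    by (intro simplex_extend_Hom long_edge_Hom)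
  show "simplex_extend 1 (Suc n) (long_edge (Suc n)) \<circ> (\<lambda>x. x + (- 1)) \<in> Hom paracyclic_cat 1 (Suc n)"
    by (rule paracyclic_Hom_comp[OF shift_Hom e])
  show "(\<lambda>x. x + (- 1)) \<circ> simplex_extend 1 (Suc n) (initial 1) \<in> Hom paracyclic_cat 1 (Suc n)"
    by (rule paracyclic_Hom_comp[OF simplex_extend_Hom[OF initial_Hom] shift_Hom]) simp
  fix k :: nat assume "k \<le> 1"
  then consider "k = 0" | "k = 1" by linarith
  then show "((\<lambda>x. x + (- 1)) \<circ> simplex_extend 1 (Suc n) (initial 1)) (int k) =
      (simplex_extend 1 (Suc n) (long_edge (Suc n)) \<circ> (\<lambda>x. x + (- 1))) (int k)"
  proof cases
    case 1
    then show ?thesis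
      using paracyclic_shift[OF e, of 1 "- 1"] simplex_extend_small[of 1 1 "Suc n" "long_edge (Suc n)"]
        simplex_extend_small[of 0 1 "Suc n" "initial 1"]
      by (simp add: initial_def long_edge_def)
  next
    case 2
    then show ?thesis
      using simplex_extend_small[of 0 1 "Suc n" "long_edge (Suc n)"]
        simplex_extend_small[of 1 1 "Suc n" "initial 1"]
      by (simp add: initial_def long_edge_def)
  qed
qed

text \<open>The forward direction is \<open>wrap_long_edge\<close>. Conversely, rotating
  \<open>v\<close> back by one turns its long edge into the edge 01 and elements of the image of
  \<open>R_0\<close> into degenerate ones; \<open>two_segal_degenerate\<close> applies, and rotating
  forward gives a preimage under \<open>R_n\<close>.\<close>

lemma wrap_image:
  assumes P: "paracyclic_set P"
    and S: "two_segal (precomp (op_cat simplex_cat) (op_functor simplex_extend) P)"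
    and v: "v \<in> Ob P (Suc n)"
  shows "v \<in> Ar P n (Suc n) (wrap n) ` Ob P n \<longleftrightarrow>
    Ar P (Suc n) 1 (simplex_extend 1 (Suc n) (long_edge (Suc n))) v \<in> Ar P 0 1 (wrap 0) ` Ob P 0"
proof
  assume "v \<in> Ar P n (Suc n) (wrap n) ` Ob P n"
  then obtain w where w: "w \<in> Ob P n" "v = Ar P n (Suc n) (wrap n) w" by auto
  let ?i = "simplex_extend 0 n (initial 0)"
  have i: "?i \<in> Hom paracyclic_cat 0 n"
    by (intro simplex_extend_Hom initial_Hom) simp
  have "Ar P (Suc n) 1 (simplex_extend 1 (Suc n) (long_edge (Suc n))) v = Ar P n 1 (?i \<circ> wrap 0) w"
    unfolding w(2) wrap_long_edge[symmetric]
    by (intro paracyclic_comp[OF P] simplex_extend_Hom long_edge_Hom wrap_Hom w)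
  also have "\<dots> = Ar P 0 1 (wrap 0) (Ar P n 0 ?i w)"
    using paracyclic_comp[OF P wrap_Hom[of 0] i w(1)] by simp
  finally show "Ar P (Suc n) 1 (simplex_extend 1 (Suc n) (long_edge (Suc n))) v \<in> Ar P 0 1 (wrap 0) ` Ob P 0"
    using paracyclic_into[OF P i w(1)] by simp
next
  assume "Ar P (Suc n) 1 (simplex_extend 1 (Suc n) (long_edge (Suc n))) v \<in> Ar P 0 1 (wrap 0) ` Ob P 0"
  then obtain y where y: "y \<in> Ob P 0"
    "Ar P (Suc n) 1 (simplex_extend 1 (Suc n) (long_edge (Suc n))) v = Ar P 0 1 (wrap 0) y" by auto
  let ?X = "precomp (op_cat simplex_cat) (op_functor simplex_extend) P"
  have X: "simplicial_set ?X"
    by (intro set_functor_precomp[OF _ _ P] category_op functor_op category_simplex functor_simplex_extend)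
  have ArX: "Ar ?X p m g = Ar P p m (simplex_extend m p g)" if "g \<in> Hom simplex_cat m p" for p m g
    using that by (simp add: Ar_precomp op_cat_def op_functor_def)
  define u where "u = Ar P (Suc n) (Suc n) (\<lambda>x. x + (- 1)) v"
  have u: "u \<in> Ob P (Suc n)" unfolding u_def by (rule paracyclic_into[OF P shift_Hom v])
  have c: "codegeneracy 0 0 \<in> Hom simplex_cat 1 0"
    using codegeneracy_Hom[of 0 0] by simp
  have "Ar P (Suc n) 1 (simplex_extend 1 (Suc n) (initial 1)) u =
      Ar P (Suc n) 1 (simplex_extend 1 (Suc n) (long_edge (Suc n)) \<circ> (\<lambda>x. x + (- 1))) v"
    unfolding u_def long_edge_shift[symmetric]
    by (intro paracyclic_comp[OF P] shift_Hom simplex_extend_Hom initial_Hom v) simp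
  also have "\<dots> = Ar P 1 1 (\<lambda>x. x + (- 1)) (Ar P 0 1 (wrap 0) y)"
    unfolding y(2)[symmetric]
    by (intro paracyclic_comp[OF P, symmetric] shift_Hom simplex_extend_Hom long_edge_Hom v)
  also have "\<dots> = Ar P 0 1 (wrap 0 \<circ> (\<lambda>x. x + (- 1))) y"
    by (rule paracyclic_comp[OF P shift_Hom wrap_Hom[of 0, folded One_nat_def] y(1)])
  also have "wrap 0 \<circ> (\<lambda>x. x + (- 1)) = simplex_extend 1 0 (codegeneracy 0 0)"
    using wrap_codegeneracy[of 0] by (simp add: fun_eq_iff)
  finally have e: "Ar P (Suc n) 1 (simplex_extend 1 (Suc n) (initial 1)) u =
      Ar P 0 1 (simplex_extend 1 0 (codegeneracy 0 0)) y" .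
  have i: "initial 1 \<in> Hom simplex_cat 1 (Suc n)" by (rule initial_Hom) simp
  have "Ar ?X (Suc n) 1 (initial 1) u \<in> Ar ?X 0 1 (codegeneracy 0 0) ` Ob ?X 0"
    unfolding ArX[OF c] ArX[OF i] Ob_precomp e using y(1) by blast
  then have "u \<in> Ar ?X n (Suc n) (codegeneracy n 0) ` Ob ?X n"
    using two_segal_degenerate[OF X S] u by simp
  then obtain w where w: "w \<in> Ob P n" "u = Ar P n (Suc n) (simplex_extend (Suc n) n (codegeneracy n 0)) w"
    by (auto simp: ArX[OF codegeneracy_Hom])
  have "Ar P n (Suc n) (wrap n) w = Ar P (Suc n) (Suc n) (\<lambda>x. x + 1) u"
    unfolding w(2) wrap_codegeneracy
    by (intro paracyclic_comp[OF P, symmetric] shift_Hom simplex_extend_Hom codegeneracy_Hom w) simp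
  also have "\<dots> = v"
    unfolding u_def using paracyclic_comp[OF P shift_Hom shift_Hom v, of 1 "- 1"] paracyclic_ident[OF P v]
    by (simp add: comp_def id_def)
  finally show "v \<in> Ar P n (Suc n) (wrap n) ` Ob P n" using w(1) by blast
qed

section \<open>The cosymmetric set\<close>

text \<open>\<open>add_point f\<close> is \<open>f\<close> under the identification of \<open>[n]\<close> with \<open>{1, \<dots>, n + 1}\<close> given by \<open>0 \<mapsto> n + 1\<close> and
  \<open>k \<mapsto> k\<close> for \<open>k \<ge> 1\<close>, extended by \<open>0 \<mapsto> 0\<close>.\<close>

definition add_point :: "nat \<Rightarrow> nat \<Rightarrow> (nat \<Rightarrow> nat) \<Rightarrow> nat \<Rightarrow> nat" where
  "add_point m n f = (\<lambda>k\<in>{..Suc m}. if k = 0 then 0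
     else let l = f (if k = Suc m then 0 else k) in if l = 0 then Suc n else l)"

lemma Phi_Hom: "f \<in> Hom Phi m n \<longleftrightarrow> f \<in> {..m} \<rightarrow>\<^sub>E {..n}"
  by (simp add: Phi_def)

lemma Phi_pointed_Hom: "f \<in> Hom Phi_pointed m n \<longleftrightarrow> f \<in> {..m} \<rightarrow>\<^sub>E {..n} \<and> f 0 = 0"
  by (simp add: Phi_pointed_def)

lemma Phi_Comp: "Comp Phi m n p g f = compose {..m} g f"
  by (simp add: Phi_def)

lemma Gamma_comp:
  assumes "Gamma_set Q" "f \<in> Hom Phi_pointed m n" "g \<in> Hom Phi_pointed n p" "x \<in> Ob Q m"
  shows "Ar Q n p g (Ar Q m n f x) = Ar Q m p (compose {..m} g f) x"
  using set_functor_Comp[OF assms] by (simp add: Phi_pointed_def Phi_def)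

lemma Cut_Hom: "f \<in> Hom simplex_cat m n \<Longrightarrow> Cut n m f \<in> Hom Phi_pointed n m"
  using functor_Cut by (simp add: is_functor_def op_cat_def)

lemma add_point_Hom:
  assumes "f \<in> Hom Phi m n"
  shows "add_point m n f \<in> Hom Phi_pointed (Suc m) (Suc n)"
proof -
  have "f k \<le> n" if "k \<le> m" for k using assms that by (auto simp: Phi_Hom)
  then show ?thesis by (auto simp: Phi_pointed_Hom add_point_def Let_def le_SucI)
qed

lemma add_point_ident: "add_point n n (\<lambda>k\<in>{..n}. k) = (\<lambda>k\<in>{..Suc n}. k)"
  by (auto simp: add_point_def Let_def fun_eq_iff)

lemma add_point_comp:
  assumes "f \<in> Hom Phi m n" "g \<in> Hom Phi n p"
  shows "add_point m p (compose {..m} g f) = compose {..Suc m} (add_point n p g) (add_point m n f)"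
proof
  fix k
  have b: "f k \<le> n" if "k \<le> m" for k using assms that by (auto simp: Phi_Hom)
  show "add_point m p (compose {..m} g f) k = compose {..Suc m} (add_point n p g) (add_point m n f) k"
    using b[of 0] b[of k] by (auto simp: add_point_def Let_def compose_def)
qed

section \<open>Pointed maps for the long edge, the last face and the rotation\<close>

lemma Cut_long_edge: "Cut (Suc n) 1 (long_edge (Suc n)) = (\<lambda>k\<in>{..Suc n}. if k = 0 then 0 else 1)"
proof
  fix k
  show "Cut (Suc n) 1 (long_edge (Suc n)) k = (\<lambda>k\<in>{..Suc n}. if k = 0 then 0 else 1) k"
  proof (cases "k \<le> Suc n")
    case True
    have "Cut (Suc n) 1 (long_edge (Suc n)) k = (if k = 0 then 0 else 1)"
      using True by (intro Cut_eqI) (auto simp: long_edge_def split: if_splits)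
    then show ?thesis using True by simp
  qed (simp add: Cut_outside)
qed

text \<open>The long edge only records whether an element is the basepoint, and
  \<open>add_point\<close> sends exactly 0 to 0. So \<open>add_point m n f\<close> acts on a
  Gamma-set without changing long edges.\<close>

lemma long_edge_add_point:
  assumes "f \<in> Hom Phi m n"
  shows "compose {..Suc m} (Cut (Suc n) 1 (long_edge (Suc n))) (add_point m n f) =
    Cut (Suc m) 1 (long_edge (Suc m))"
proof -
  have b: "f k \<le> n" if "k \<le> m" for k using assms that by (auto simp: Phi_Hom)
  show ?thesis
    unfolding Cut_long_edge
  proof
    fix k
    show "compose {..Suc m} (\<lambda>k\<in>{..Suc n}. if k = 0 then 0 else 1) (add_point m n f) k =
        (\<lambda>k\<in>{..Suc m}. if k = 0 then 0 else 1) k"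
      using b[of 0] b[of k] by (auto simp: compose_def add_point_def Let_def)
  qed
qed

text \<open>The last face sends \<open>n + 1\<close> back to 0, undoing the relabelling in
  \<open>add_point\<close>. At the added basepoint 0 the two sides agree only because
  \<open>f 0 = 0\<close>.\<close>

lemma drop_last_add_point:
  assumes "f \<in> Hom Phi_pointed m n"
  shows "compose {..Suc m} (Cut (Suc n) n (coface (Suc n) (Suc n))) (add_point m n f) =
    compose {..Suc m} f (Cut (Suc m) m (coface (Suc m) (Suc m)))"
proof -
  have b: "f k \<le> n" if "k \<le> m" for k using assms that by (auto simp: Phi_pointed_Hom)
  have f0: "f 0 = 0" using assms by (simp add: Phi_pointed_Hom)
  note C = Cut_coface_last[of "Suc _", simplified]
  have "f k \<le> Suc n" if "k \<le> m" for k using b[OF that] by simp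
  then show ?thesis
    unfolding C by (auto simp: fun_eq_iff compose_def add_point_def Let_def f0 b less_Suc_eq_le)
qed

text \<open>Both sides fix 0 and lower every other element by one. With \<open>wrap_coface_0\<close>
  this identifies the action of the cyclic permutation with that of \<open>rotation\<close>.\<close>

lemma drop_last_add_point_rotation:
  "compose {..Suc n} (Cut (Suc n) n (coface (Suc n) (Suc n)))
     (add_point n n (\<lambda>k\<in>{..n}. if k = 0 then n else k - 1)) = Cut (Suc n) n (coface (Suc n) 0)"
proof -
  note C = Cut_coface_last[of "Suc n", simplified] Cut_coface_less[of 0 "Suc n", simplified]
  show ?thesis
    unfolding C by (auto simp: fun_eq_iff compose_def add_point_def Let_def)
qed

section \<open>Uniqueness of the cosymmetric set\<close>

text \<open>A cyclic permutation carrying 0 to \<open>f 0\<close> can be split off on the left,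
  leaving a pointed map.\<close>

lemma Phi_factor:
  assumes f: "f \<in> Hom Phi m n"
  obtains g a where "g \<in> Hom Phi_pointed m n"
    "f = compose {..m} (cyclic_to_Phi n n (cyclic_class n n (\<lambda>x. x + a))) g"
proof -
  define a where "a = f 0"
  have b: "f k \<le> n" if "k \<le> m" for k using f that by (auto simp: Phi_Hom)
  have a: "a \<le> n" using b[of 0] by (simp add: a_def)
  \<comment> \<open>Adding \<open>n + 1\<close> first keeps the subtraction of naturals from
    truncating.\<close>
  define g where "g = (\<lambda>k\<in>{..m}. (f k + (n + 1) - a) mod (n + 1))"
  \<comment> \<open>The left adjoint of a shift is its inverse, so the required shift is by
    \<open>- int a\<close>.\<close>
  have "left_adjoint (\<lambda>x. x + (- int a)) k = k + int a" for k
    by (rule left_adjoint_eqI[OF shift_Hom]) auto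
  then have rot: "cyclic_to_Phi n n (cyclic_class n n (\<lambda>x. x + (- int a))) = (\<lambda>k\<in>{..n}. (k + a) mod (n + 1))"
    unfolding cyclic_to_Phi_class[OF shift_Hom] by (auto simp: fun_eq_iff nat_mod_distrib nat_add_distrib)
  have gn: "g k \<le> n" if "k \<le> m" for k
    using that by (simp add: g_def less_Suc_eq_le[symmetric])
  have "f k = compose {..m} (cyclic_to_Phi n n (cyclic_class n n (\<lambda>x. x + (- int a)))) g k" for k
  proof (cases "k \<le> m")
    case True
    have "(g k + a) mod (n + 1) = (f k + (n + 1) - a + a) mod (n + 1)"
      using True unfolding g_def by (simp add: mod_add_left_eq)
    also have "f k + (n + 1) - a + a = f k + (n + 1)" using a by simp
    also have "\<dots> mod (n + 1) = f k mod (n + 1)" by (rule mod_add_self2)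
    also have "\<dots> = f k" using b[OF True] by simp
    finally have "(g k + a) mod (n + 1) = f k" .
    moreover have "compose {..m} (cyclic_to_Phi n n (cyclic_class n n (\<lambda>x. x + (- int a)))) g k =
        (g k + a) mod (n + 1)"
      using True gn[OF True] by (simp only: rot compose_def restrict_apply' atMost_iff)
    ultimately show ?thesis by (simp only:)
  next
    case False
    with f have "f k = undefined" unfolding Phi_Hom by (elim PiE_arb) simp
    then show ?thesis using False by (simp add: compose_def)
  qed
  moreover have "g \<in> Hom Phi_pointed m n"
    using gn by (auto simp: Phi_pointed_Hom g_def a_def)
  ultimately show ?thesis using that by blast
qed

text \<open>By \<open>Phi_factor\<close>, pointed maps and cyclic permutations generate
  \<open>Phi\<close>, and the two restrictions prescribe the action of both.\<close>

lemma cosymmetric_set_eqI: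
  assumes F: "cosymmetric_set F" and F': "cosymmetric_set F'"
    and cyc: "precomp (op_cat cyclic_cat) cyclic_to_Phi F = precomp (op_cat cyclic_cat) cyclic_to_Phi F'"
    and inc: "precomp Phi_pointed incl F = precomp Phi_pointed incl F'"
  shows "F = F'"
proof (rule set_functor_eqI[OF F F'])
  show ob: "Ob F = Ob F'" using inc by (metis Ob_precomp)
  fix m n f x assume f: "f \<in> Hom Phi m n" and x: "x \<in> Ob F m"
  from f obtain g a where g: "g \<in> Hom Phi_pointed m n"
    and f_eq: "f = compose {..m} (cyclic_to_Phi n n (cyclic_class n n (\<lambda>x. x + a))) g"
    by (rule Phi_factor)
  let ?A = "cyclic_class n n (\<lambda>x. x + a)"
  have A: "?A \<in> Hom (op_cat cyclic_cat) n n"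
    using shift_Hom by (simp add: op_cat_def cyclic_cat_def)
  have r: "cyclic_to_Phi n n ?A \<in> Hom Phi n n"
    using functor_cyclic_to_Phi A unfolding is_functor_def by blast
  have g': "g \<in> Hom Phi m n" using g by (simp add: Phi_Hom Phi_pointed_Hom)
  have "Ar F m n g = Ar F' m n g"
    using Ar_precomp[OF g, of incl F] Ar_precomp[OF g, of incl F'] inc by (simp add: incl_def)
  moreover have "Ar F n n (cyclic_to_Phi n n ?A) = Ar F' n n (cyclic_to_Phi n n ?A)"
    using Ar_precomp[OF A, of cyclic_to_Phi F] Ar_precomp[OF A, of cyclic_to_Phi F'] cyc by simp
  ultimately show "Ar F m n f x = Ar F' m n f x"
    using set_functor_Comp[OF F g' r x] set_functor_Comp[OF F' g' r, of x] x ob f_eq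
    by (simp add: Phi_Comp)
qed

section \<open>Existence of the cosymmetric set\<close>

definition cosymmetric_extension ::
  "(int \<Rightarrow> int, 'a) set_functor \<Rightarrow> (nat \<Rightarrow> nat, 'a) set_functor \<Rightarrow> (nat \<Rightarrow> nat, 'a) set_functor" where
  "cosymmetric_extension P Q = \<lparr>Ob = Ob P, Ar = (\<lambda>m n f. if f \<in> Hom Phi m n then
     (\<lambda>x\<in>Ob P m. Ar Q (Suc n) n (Cut (Suc n) n (coface (Suc n) (Suc n)))
        (Ar Q (Suc m) (Suc n) (add_point m n f) (Ar P m (Suc m) (wrap m) x)))
     else undefined)\<rparr>"

lemma ex_cosymmetric_extension:
  fixes P :: "(int \<Rightarrow> int, 'a) set_functor"
  assumes P: "paracyclic_set P" and Q: "Gamma_set Q"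
    and PQ: "precomp (op_cat simplex_cat) (op_functor simplex_extend) P = precomp (op_cat simplex_cat) Cut Q"
    and S: "two_segal (precomp (op_cat simplex_cat) Cut Q)"
  obtains F where "cosymmetric_set F" "Ob F = Ob P" "precomp Phi_pointed incl F = Q"
    "\<And>n x. x \<in> Ob P n \<Longrightarrow> Ar F n n (\<lambda>k\<in>{..n}. if k = 0 then n else k - 1) x = Ar P n n rotation x"
proof -
  have ob: "Ob Q = Ob P" using PQ by (metis Ob_precomp)
  \<comment> \<open>The two structures interact only through the shared simplicial action, so each
    passage between \<open>P\<close> and \<open>Q\<close> uses this equation.\<close>
  have PQ': "Ar Q n m (Cut n m f) = Ar P n m (simplex_extend m n f)" if "f \<in> Hom simplex_cat m n" for m n f
    using PQ Ar_precomp[of f "op_cat simplex_cat" n m] that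
    by (metis (no_types, lifting) op_cat_def op_functor_def nat_cat.select_convs(1))
  define d where "d n = Ar Q (Suc n) n (Cut (Suc n) n (coface (Suc n) (Suc n)))" for n
  define R where "R n = Ar P n (Suc n) (wrap n)" for n
  define F where "F = cosymmetric_extension P Q"
  have F_ob: "Ob F = Ob P" by (simp add: F_def cosymmetric_extension_def)
  have F_ar: "Ar F m n f x = d n (Ar Q (Suc m) (Suc n) (add_point m n f) (R m x))"
    if "f \<in> Hom Phi m n" "x \<in> Ob P m" for m n f x
    using that by (simp add: F_def cosymmetric_extension_def d_def R_def)
  have F_out: "Ar F m n f x = undefined" if "f \<in> Hom Phi m n" "x \<notin> Ob P m" for m n f x
    using that by (simp add: F_def cosymmetric_extension_def)
  have d_into: "d n x \<in> Ob P n" if "x \<in> Ob P (Suc n)" for n x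
    using set_functor_into[OF Q Cut_Hom[OF coface_Hom]] that by (simp add: d_def ob)
  have R_into: "R n x \<in> Ob P (Suc n)" if "x \<in> Ob P n" for n x
    unfolding R_def by (rule paracyclic_into[OF P wrap_Hom that])
  have dR: "d n (R n x) = x" if "x \<in> Ob P n" for n x
    using paracyclic_comp[OF P simplex_extend_Hom[OF coface_Hom] wrap_Hom that]
    by (simp add: d_def R_def PQ' coface_Hom wrap_coface_last paracyclic_ident[OF P that])
  have rotate: "Ar Q (Suc n) n (Cut (Suc n) n (coface (Suc n) 0)) (R n x) = Ar P n n rotation x"
    if "x \<in> Ob P n" for n x
    using paracyclic_comp[OF P simplex_extend_Hom[OF coface_Hom] wrap_Hom that]
    by (simp add: R_def PQ' coface_Hom wrap_coface_0)
  have image: "v \<in> R n ` Ob P n \<longleftrightarrow> Ar Q (Suc n) 1 (Cut (Suc n) 1 (long_edge (Suc n))) v \<in> R 0 ` Ob P 0"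
    if "v \<in> Ob P (Suc n)" for n v
    unfolding R_def PQ'[OF long_edge_Hom] using wrap_image[OF P S[folded PQ] that] by simp
  \<comment> \<open>This is the crux: \<open>R\<close> intertwines \<open>F\<close> with the action
    of \<open>add_point\<close>, so functoriality of \<open>F\<close> reduces to that of
    \<open>add_point\<close>.\<close>
  have RF: "R n (Ar F m n f x) = Ar Q (Suc m) (Suc n) (add_point m n f) (R m x)"
    if f: "f \<in> Hom Phi m n" and x: "x \<in> Ob P m" for m n f x
  proof -
    let ?v = "Ar Q (Suc m) (Suc n) (add_point m n f) (R m x)"
    have Rx: "R m x \<in> Ob Q (Suc m)" using R_into[OF x] ob by simp
    have v: "?v \<in> Ob P (Suc n)"
      using set_functor_into[OF Q add_point_Hom[OF f] Rx] ob by simp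
    have "Ar Q (Suc n) 1 (Cut (Suc n) 1 (long_edge (Suc n))) ?v =
        Ar Q (Suc m) 1 (Cut (Suc m) 1 (long_edge (Suc m))) (R m x)"
      using Gamma_comp[OF Q add_point_Hom[OF f] Cut_Hom[OF long_edge_Hom] Rx]
      by (simp add: long_edge_add_point[OF f, simplified])
    also have "\<dots> \<in> R 0 ` Ob P 0" using image[OF R_into[OF x]] x by blast
    finally have "?v \<in> R n ` Ob P n" using image[OF v] by blast
    \<comment> \<open>If \<open>?v = R n w\<close>, then \<open>F f x = d n ?v = w\<close> by
      \<open>dR\<close>.\<close>
    then show ?thesis using F_ar[OF f x] dR by auto
  qed
  have F_into: "Ar F m n f x \<in> Ob P n" if f: "f \<in> Hom Phi m n" and x: "x \<in> Ob P m" for m n f x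
    unfolding F_ar[OF that] using set_functor_into[OF Q add_point_Hom[OF f]] R_into[OF x] ob
    by (auto intro: d_into)
  have "cosymmetric_set F"
    unfolding is_set_functor_def
  proof (intro conjI allI impI)
    show "Ar F m n f \<in> Ob F m \<rightarrow>\<^sub>E Ob F n" if f: "f \<in> Hom Phi m n" for m n f
      using F_into[OF f] F_out[OF f] unfolding F_ob by blast
    show "Ar F m n f = undefined" if "f \<notin> Hom Phi m n" for m n f
      using that by (simp add: F_def cosymmetric_extension_def)
  next
    fix n
    have i: "(\<lambda>k\<in>{..n}. k) \<in> Hom Phi n n" by (simp add: Phi_Hom)
    have "Ar F n n (\<lambda>k\<in>{..n}. k) x = x" if x: "x \<in> Ob P n" for x
      using F_ar[OF i x] set_functor_Ident[OF Q, of "R n x" "Suc n"] R_into[OF x] dR[OF x] ob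
      by (simp add: add_point_ident Phi_pointed_def Phi_def)
    then show "Ar F n n (Ident Phi n) = (\<lambda>x\<in>Ob F n. x)"
      using F_out[OF i] by (auto simp: F_ob Phi_def fun_eq_iff)
  next
    fix m n p f g assume f: "f \<in> Hom Phi m n" and g: "g \<in> Hom Phi n p"
    have gf: "compose {..m} g f \<in> Hom Phi m p"
      using f g by (auto simp: Phi_Hom compose_def)
    have "Ar F m p (compose {..m} g f) x = Ar F n p g (Ar F m n f x)" if x: "x \<in> Ob P m" for x
      using F_ar[OF gf x] F_ar[OF g F_into[OF f x]] RF[OF f x]
        Gamma_comp[OF Q add_point_Hom[OF f] add_point_Hom[OF g], of "R m x"] R_into[OF x] ob
      by (simp add: add_point_comp[OF f g])
    then show "Ar F m p (Comp Phi m n p g f) = compose (Ob F m) (Ar F n p g) (Ar F m n f)"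
      using F_out[OF gf] by (auto simp: F_ob Phi_Comp compose_def[of "Ob P m"] fun_eq_iff)
  qed
  moreover have "precomp Phi_pointed incl F = Q"
  proof (rule set_functor_eqI[OF set_functor_precomp[OF category_Phi_pointed functor_incl \<open>cosymmetric_set F\<close>] Q])
    show "Ob (precomp Phi_pointed incl F) = Ob Q" by (simp add: F_ob ob)
    fix m n f x assume f: "f \<in> Hom Phi_pointed m n" and "x \<in> Ob (precomp Phi_pointed incl F) m"
    then have x: "x \<in> Ob P m" by (simp add: F_ob)
    have f': "f \<in> Hom Phi m n" using f by (simp add: Phi_Hom Phi_pointed_Hom)
    have Rx: "R m x \<in> Ob Q (Suc m)" using R_into[OF x] ob by simp
    \<comment> \<open>Pointedness moves the last face past \<open>f\<close>, after which it cancels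
      against \<open>R m\<close>.\<close>
    have "Ar F m n f x = Ar Q m n f (d m (R m x))"
      unfolding F_ar[OF f' x] d_def
      using Gamma_comp[OF Q add_point_Hom[OF f'] Cut_Hom[OF coface_Hom] Rx]
        Gamma_comp[OF Q Cut_Hom[OF coface_Hom] f Rx] drop_last_add_point[OF f] by simp
    then show "Ar (precomp Phi_pointed incl F) m n f x = Ar Q m n f x"
      by (simp add: Ar_precomp[OF f] incl_def dR[OF x])
  qed
  moreover have "Ar F n n (\<lambda>k\<in>{..n}. if k = 0 then n else k - 1) x = Ar P n n rotation x"
    if x: "x \<in> Ob P n" for n x
  proof -
    have r: "(\<lambda>k\<in>{..n}. if k = 0 then n else k - 1) \<in> Hom Phi n n" by (auto simp: Phi_Hom)
    have "Ar F n n (\<lambda>k\<in>{..n}. if k = 0 then n else k - 1) x =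
        Ar Q (Suc n) n (Cut (Suc n) n (coface (Suc n) 0)) (R n x)"
      unfolding F_ar[OF r x] d_def
      using Gamma_comp[OF Q add_point_Hom[OF r] Cut_Hom[OF coface_Hom], of "R n x"] R_into[OF x] ob
      by (simp only: drop_last_add_point_rotation)
    then show ?thesis using rotate[OF x] by simp
  qed
  ultimately show ?thesis using that F_ob by blast
qed

theorem theorem4p1:
  fixes P :: "(int \<Rightarrow> int, 'a) set_functor"
    and Q :: "(nat \<Rightarrow> nat, 'a) set_functor"
  assumes "paracyclic_set P"
    and "Gamma_set Q"
    and "precomp (op_cat simplex_cat) (op_functor simplex_extend) P = precomp (op_cat simplex_cat) Cut Q"
    and "two_segal (precomp (op_cat simplex_cat) Cut Q)"
  shows "\<exists>P'. cyclic_set P' \<and>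
    precomp (op_cat paracyclic_cat) (op_functor cyclic_class) P' = P \<and>
    (\<exists>!F. cosymmetric_set F \<and>
       precomp (op_cat cyclic_cat) cyclic_to_Phi F = P' \<and>
       precomp Phi_pointed incl F = Q)"
proof -
  obtain F where F: "cosymmetric_set F" and ob: "Ob F = Ob P" and FQ: "precomp Phi_pointed incl F = Q"
    and rot: "\<And>n x. x \<in> Ob P n \<Longrightarrow> Ar F n n (\<lambda>k\<in>{..n}. if k = 0 then n else k - 1) x = Ar P n n rotation x"
    using ex_cosymmetric_extension[OF assms] by blast
  \<comment> \<open>Since \<open>P'\<close> is a cyclic set by construction, cyclicity of
    \<open>P\<close> amounts to showing that its pullback \<open>G\<close> equals \<open>P\<close>;
    this is checked on simplicial arrows and on \<open>rotation\<close>.\<close>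
  define P' where "P' = precomp (op_cat cyclic_cat) cyclic_to_Phi F"
  have P': "cyclic_set P'"
    unfolding P'_def by (intro set_functor_precomp[OF _ functor_cyclic_to_Phi F] category_op category_cyclic)
  define G where "G = precomp (op_cat paracyclic_cat) (op_functor cyclic_class) P'"
  have G: "paracyclic_set G"
    unfolding G_def
    by (intro set_functor_precomp[OF _ _ P'] category_op functor_op category_paracyclic functor_cyclic_class)
  have G_ar: "Ar G n m f = Ar F n m (cyclic_to_Phi n m (cyclic_class m n f))"
    if "f \<in> Hom paracyclic_cat m n" for m n f
    using that by (simp add: G_def P'_def precomp_def op_cat_def op_functor_def cyclic_cat_def)
  have "G = P"
  proof (rule paracyclic_set_eqI[OF G assms(1)])
    show "Ob G = Ob P" by (simp add: G_def P'_def ob)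
    fix m n g x assume g: "g \<in> Hom simplex_cat m n"
    have "Ar G n m (simplex_extend m n g) = Ar F n m (incl n m (Cut n m g))"
      by (simp add: G_ar simplex_extend_Hom[OF g] cyclic_to_Phi_simplex_extend[OF g])
    also have "\<dots> = Ar Q n m (Cut n m g)"
      using Ar_precomp[OF Cut_Hom[OF g], of incl F] FQ by simp
    also have "\<dots> = Ar P n m (simplex_extend m n g)"
      using assms(3) Ar_precomp[of g "op_cat simplex_cat" n m] g
      by (metis (no_types, lifting) op_cat_def op_functor_def nat_cat.select_convs(1))
    finally show "Ar G n m (simplex_extend m n g) x = Ar P n m (simplex_extend m n g) x" by simp
  next
    fix n x assume "x \<in> Ob G n"
    then have "x \<in> Ob P n" by (simp add: G_def P'_def ob)
    then show "Ar G n n rotation x = Ar P n n rotation x"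
      using rot by (simp add: G_ar rotation_Hom cyclic_to_Phi_rotation)
  qed
  moreover have "\<exists>!F. cosymmetric_set F \<and> precomp (op_cat cyclic_cat) cyclic_to_Phi F = P' \<and>
      precomp Phi_pointed incl F = Q"
    using F FQ cosymmetric_set_eqI by (intro ex1I[of _ F]) (auto simp: P'_def)
  ultimately show ?thesis using P' unfolding G_def by blast
qed

end
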